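(* For every partition $\lambda=(\lambda_1,\dots,\lambda_l)$ and every $n\ge 0$, $\langle S_\lambda\rangle_n$ is the coefficient of $t^\lambda v^n$ in $$\prod_{1\le i<j\le l}(1-t_j/t_i)\prod_{R\sqsubset[l]}(1-t^Rv)^{-1}.$$
   Context: Let $K$ be a field of characteristic $0$ and $P=K[X_1,X_2,\dots]$. For $w\in S_n$ let $X_i(w)$ be the number of $i$-cycles of $w$. For $q\in P$, $\langle q\rangle_n=\frac1{n!}\sum_{w\in S_n}q(X_1(w),X_2(w),\dots)$. Define $H_d\in P$ ($d\ge0$) by $\sum_{d\ge0}H_dt^d=\prod_{i\ge1}(1-t^i)^{-X_i}$ in $P[[t]]$ (binomial series), $H_d=0$ for $d<0$, and $S_\lambda=\det(H_{\lambda_i+j-i})_{1\le i,j\le l}$. $S_\lambda$ is the character polynomial of the family of restrictions to $S_n$ (permutation matrices) of the Weyl modules $W_\lambda(K^n)$, so for $n\ge1$, $\langle S_\lambda\rangle_n=\dim W_\lambda(K^n)^{S_n}$. $t^\lambda=t_1^{\lambda_1}\cdots t_l^{\lambda_l}$. $R\sqsubset[l]$ means that $R$ is a finite multiset (possibly empty) with elements drawn from $[l]=\{1,\dots,l\}$; $t^R$ is the monomial in which $t_i$ is raised to the multiplicity of $i$ in $R$. The second product is a formal power series in $t_1,\dots,t_l,v$, and the first is a Laurent polynomial in $t_1,\dots,t_l$. *)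

theory Defs
  imports
    "HOL-Library.Poly_Mapping"
    "HOL-Library.Multiset"
    "HOL-Computational_Algebra.Formal_Power_Series"
    "HOL-Combinatorics.Orbits"
    "HOL-Analysis.Infinite_Products"
    "Jordan_Normal_Form.Determinant"
begin

section \<open>Character polynomials\<close>

text \<open>
  The polynomial ring in variables \<open>X\<^sub>0, X\<^sub>1, X\<^sub>2, \<dots>\<close>: finitely supported maps from
  exponents to coefficients, with the convolution product of \<^theory>\<open>HOL-Library.Poly_Mapping\<close>.
  The polynomials considered below do not involve \<open>X\<^sub>0\<close>.
\<close>

type_synonym 'k cpoly = "(nat \<Rightarrow>\<^sub>0 nat) \<Rightarrow>\<^sub>0 'k"

definition cX :: "nat \<Rightarrow> 'k::comm_ring_1 cpoly" where
  "cX i = Poly_Mapping.single (Poly_Mapping.single i 1) 1"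

definition cconst :: "'k::comm_ring_1 \<Rightarrow> 'k cpoly" where
  "cconst c = Poly_Mapping.single 0 c"

definition ceval :: "'k::comm_ring_1 cpoly \<Rightarrow> (nat \<Rightarrow> 'k) \<Rightarrow> 'k" where
  "ceval q x = (\<Sum>m\<in>Poly_Mapping.keys q.
     Poly_Mapping.lookup q m * (\<Prod>i\<in>Poly_Mapping.keys m. x i ^ Poly_Mapping.lookup m i))"

definition num_cycles :: "nat \<Rightarrow> (nat \<Rightarrow> nat) \<Rightarrow> nat \<Rightarrow> nat" where
  "num_cycles n w i = card {C \<in> orbit w ` {1..n}. card C = i}"

definition avg :: "nat \<Rightarrow> 'k::field_char_0 cpoly \<Rightarrow> 'k" where
  "avg n q = (\<Sum>w | w permutes {1..n}. ceval q (\<lambda>i. of_nat (num_cycles n w i))) / fact n"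

text \<open>
  The binomial series \<open>(1 + t)\<^sup>a = (\<Sum>k. binom(a, k) t\<^sup>k)\<close> for a polynomial \<open>a\<close>. The library's
  \<open>gbinomial\<close> and \<open>fps_binomial\<close> do not apply, as they need a division on the coefficients.
\<close>

definition cbinomial_series :: "'k::field_char_0 cpoly \<Rightarrow> 'k cpoly fps" where
  "cbinomial_series a = Abs_fps (\<lambda>k. cconst (1 / fact k) * (\<Prod>i<k. a - of_nat i))"

definition cH :: "int \<Rightarrow> 'k::field_char_0 cpoly" where
  "cH d = (if d < 0 then 0 else
     fps_nth (prodinf (\<lambda>i. cbinomial_series (- cX (Suc i)) oo (- (fps_X ^ Suc i)))) (nat d))"

definition cS :: "nat list \<Rightarrow> 'k::field_char_0 cpoly" where
  "cS lam = Determinant.det (mat (length lam) (length lam)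
     (\<lambda>(i, j). cH (int (lam ! i) + int j - int i)))"


section \<open>Formal power series in several variables\<close>

text \<open>
  Power series in a possibly infinite set \<open>'x\<close> of variables: arbitrary families of coefficients
  indexed by the monomials, i.e. by finitely supported exponents.
\<close>

typedef (overloaded) ('x, 'a) mfps = "UNIV :: (('x \<Rightarrow>\<^sub>0 nat) \<Rightarrow> 'a) set"
  morphisms mfps_nth Abs_mfps by simp

setup_lifting type_definition_mfps

lemma mfps_eqI: "(\<And>m. mfps_nth f m = mfps_nth g m) \<Longrightarrow> f = g"
  by transfer auto

lemma finite_splittings: "finite {(a, b). a + b = (m :: 'x \<Rightarrow>\<^sub>0 nat)}"
proof -
  let ?K = "Poly_Mapping.keys m"
  let ?N = "{..\<Sum>x\<in>?K. Poly_Mapping.lookup m x}"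
  let ?F = "{f. \<forall>x. (x \<in> ?K \<longrightarrow> f x \<in> ?N) \<and> (x \<notin> ?K \<longrightarrow> f x = (0::nat))}"
  have le: "Poly_Mapping.lookup a x \<in> ?N" if "Poly_Mapping.lookup a x \<le> Poly_Mapping.lookup m x" "x \<in> ?K"
    for a :: "'x \<Rightarrow>\<^sub>0 nat" and x
    using that member_le_sum[of x ?K "Poly_Mapping.lookup m"] by force
  have F: "finite ?F"
    by (rule finite_set_of_finite_funs) auto
  have "Poly_Mapping.lookup a \<in> ?F" if "a + b = m \<or> b + a = m" for a b :: "'x \<Rightarrow>\<^sub>0 nat"
  proof -
    have *: "Poly_Mapping.lookup a x \<le> Poly_Mapping.lookup m x" for x
      using that by (auto simp: lookup_add)
    moreover have "Poly_Mapping.lookup a x = 0" if "x \<notin> ?K" for x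
      using *[of x] that by (simp add: in_keys_iff)
    ultimately show ?thesis using le by blast
  qed
  then have "{(a, b). a + b = m} \<subseteq> (Poly_Mapping.lookup -` ?F) \<times> (Poly_Mapping.lookup -` ?F)"
    by blast
  moreover have "finite (Poly_Mapping.lookup -` ?F :: ('x \<Rightarrow>\<^sub>0 nat) set)"
    by (rule finite_vimageI[OF F]) (auto simp: inj_def poly_mapping_eqI)
  ultimately show ?thesis by (meson finite_SigmaI finite_subset)
qed

instantiation mfps :: (type, comm_ring_1) comm_ring_1
begin

lift_definition zero_mfps :: "('a, 'b) mfps" is "\<lambda>_. 0" .
lift_definition one_mfps :: "('a, 'b) mfps" is "\<lambda>m. if m = 0 then 1 else 0" .
lift_definition plus_mfps :: "('a, 'b) mfps \<Rightarrow> ('a, 'b) mfps \<Rightarrow> ('a, 'b) mfps"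
  is "\<lambda>f g m. f m + g m" .
lift_definition minus_mfps :: "('a, 'b) mfps \<Rightarrow> ('a, 'b) mfps \<Rightarrow> ('a, 'b) mfps"
  is "\<lambda>f g m. f m - g m" .
lift_definition uminus_mfps :: "('a, 'b) mfps \<Rightarrow> ('a, 'b) mfps" is "\<lambda>f m. - f m" .
lift_definition times_mfps :: "('a, 'b) mfps \<Rightarrow> ('a, 'b) mfps \<Rightarrow> ('a, 'b) mfps"
  is "\<lambda>f g m. \<Sum>(a, b) | a + b = m. f a * g b" .

instance
proof
  fix f g h :: "('a, 'b) mfps"
  show "f + g + h = f + (g + h)" "f + g = g + f" "0 + f = f" "- f + f = 0" "f - g = f + - g"
    by (transfer; simp add: algebra_simps)+
  show "(f + g) * h = f * h + g * h"
    by transfer (simp only: distrib_right sum.distrib case_prod_unfold)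
  show "f * g = g * f"
  proof (transfer, rule ext)
    fix f g :: "('a \<Rightarrow>\<^sub>0 nat) \<Rightarrow> 'b" and m
    show "(\<Sum>(a, b) | a + b = m. f a * g b) = (\<Sum>(a, b) | a + b = m. g a * f b)"
      by (rule sum.reindex_bij_witness[where i = prod.swap and j = prod.swap])
        (auto simp: add.commute mult.commute)
  qed
  show "1 * f = f"
  proof (transfer, rule ext)
    fix f :: "('a \<Rightarrow>\<^sub>0 nat) \<Rightarrow> 'b" and m
    have "(\<Sum>(a, b) | a + b = m. (if a = 0 then 1 else 0) * f b) =
      (\<Sum>(a, b)\<in>{(0 :: 'a \<Rightarrow>\<^sub>0 nat, m)}. (if a = 0 then 1 else 0) * f b)"
      by (rule sum.mono_neutral_right) (auto simp: finite_splittings split: if_splits)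
    then show "(\<Sum>(a, b) | a + b = m. (if a = 0 then 1 else 0) * f b) = f m"
      by simp
  qed
  show "f * g * h = f * (g * h)"
  proof (transfer, rule ext)
    fix f g h :: "('a \<Rightarrow>\<^sub>0 nat) \<Rightarrow> 'b" and m
    have "(\<Sum>(a, b) | a + b = m. (\<Sum>(c, d) | c + d = a. f c * g d) * h b) =
      (\<Sum>x\<in>{(a, b). a + b = m}. \<Sum>y\<in>{(c, d). c + d = fst x}. f (fst y) * g (snd y) * h (snd x))"
      by (simp only: case_prod_unfold sum_distrib_right)
    also have "\<dots> = (\<Sum>(x, y)\<in>(SIGMA x:{(a, b). a + b = m}. {(c, d). c + d = fst x}).
        f (fst y) * g (snd y) * h (snd x))"
      by (rule sum.Sigma) (auto simp: finite_splittings)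
    also have "\<dots> = (\<Sum>(x, y)\<in>(SIGMA x:{(a, b). a + b = m}. {(c, d). c + d = snd x}).
        f (fst x) * (g (fst y) * h (snd y)))"
      by (rule sum.reindex_bij_witness[where
            j = "\<lambda>((a, b), (c, d)). ((c, d + b), (d, b))" and
            i = "\<lambda>((a, b), (c, d)). ((a + c, d), (a, c))"])
        (auto simp: add.assoc mult.assoc)
    also have "\<dots> = (\<Sum>x\<in>{(a, b). a + b = m}. \<Sum>y\<in>{(c, d). c + d = snd x}.
        f (fst x) * (g (fst y) * h (snd y)))"
      by (rule sum.Sigma[symmetric]) (auto simp: finite_splittings)
    also have "\<dots> = (\<Sum>(a, b) | a + b = m. f a * (\<Sum>(c, d) | c + d = b. g c * h d))"
      by (simp only: case_prod_unfold sum_distrib_left)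
    finally show "(\<Sum>(a, b) | a + b = m. (\<Sum>(c, d) | c + d = a. f c * g d) * h b) =
      (\<Sum>(a, b) | a + b = m. f a * (\<Sum>(c, d) | c + d = b. g c * h d))" .
  qed
  show "(0 :: ('a, 'b) mfps) \<noteq> 1"
    by transfer (metis zero_neq_one)
qed

end

instantiation mfps :: (type, comm_ring_1) inverse
begin

definition inverse_mfps :: "('a, 'b) mfps \<Rightarrow> ('a, 'b) mfps" where
  "inverse_mfps f = (if \<exists>g. f * g = 1 then THE g. f * g = 1 else 0)"

definition divide_mfps :: "('a, 'b) mfps \<Rightarrow> ('a, 'b) mfps \<Rightarrow> ('a, 'b) mfps" where
  "divide_mfps f g = f * inverse g"

instance ..

end

lemma inverse_mfps_unique:
  fixes f g :: "('x, 'a::comm_ring_1) mfps"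
  assumes "f * g = 1"
  shows "inverse f = g"
proof -
  have "h = g" if "f * h = 1" for h
  proof -
    have "h = (f * g) * h" by (simp only: assms mult_1_left)
    also have "\<dots> = (f * h) * g" by (simp only: mult_ac)
    finally show ?thesis by (simp only: that mult_1_left)
  qed
  with assms have "(THE h. f * h = 1) = g" by (rule the_equality)
  moreover from assms have "\<exists>h. f * h = 1" ..
  ultimately show ?thesis by (simp only: inverse_mfps_def if_True)
qed

definition mvar :: "'x \<Rightarrow> ('x, 'a::comm_ring_1) mfps" where
  "mvar x = Abs_mfps (\<lambda>m. if m = Poly_Mapping.single x 1 then 1 else 0)"

text \<open>
  Infinite products over an arbitrary index set, with coefficientwise convergence: each
  coefficient is the eventually constant value of that coefficient along the finite
  subproducts, ordered by inclusion.
\<close>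

definition mfps_prod :: "('i \<Rightarrow> ('x, 'a::comm_ring_1) mfps) \<Rightarrow> 'i set \<Rightarrow> ('x, 'a) mfps" where
  "mfps_prod f I = Abs_mfps (\<lambda>m. THE c.
     \<forall>\<^sub>F F in finite_subsets_at_top I. mfps_nth (\<Prod>i\<in>F. f i) m = c)"


section \<open>Laurent polynomials acting on power series\<close>

type_synonym ('x, 'a) laurent = "('x \<Rightarrow>\<^sub>0 int) \<Rightarrow>\<^sub>0 'a"

definition lratio :: "'x \<Rightarrow> 'x \<Rightarrow> ('x, 'a::comm_ring_1) laurent" where
  "lratio y x = Poly_Mapping.single (Poly_Mapping.single y 1 - Poly_Mapping.single x 1) 1"

definition mfps_nth_int :: "('x, 'a::comm_ring_1) mfps \<Rightarrow> ('x \<Rightarrow>\<^sub>0 int) \<Rightarrow> 'a" where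
  "mfps_nth_int f e = (if \<forall>x. 0 \<le> Poly_Mapping.lookup e x
     then mfps_nth f (Poly_Mapping.map nat e) else 0)"

text \<open>The coefficient at exponent \<open>e\<close> of the product of a Laurent polynomial and a power series.\<close>

definition laurent_mfps_coeff ::
    "('x, 'a::comm_ring_1) laurent \<Rightarrow> ('x, 'a) mfps \<Rightarrow> ('x \<Rightarrow>\<^sub>0 int) \<Rightarrow> 'a" where
  "laurent_mfps_coeff p f e =
     (\<Sum>a\<in>Poly_Mapping.keys p. Poly_Mapping.lookup p a * mfps_nth_int f (e - a))"


section \<open>The generating function\<close>

text \<open>
  Only \<open>T 1, \<dots>, T l\<close> and \<open>V\<close> occur below, so the series lie in the subring of power series
  in \<open>t\<^sub>1, \<dots>, t\<^sub>l, v\<close>.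
\<close>

datatype gvar = T nat | V

definition vandermonde_factor :: "nat \<Rightarrow> (gvar, 'a::comm_ring_1) laurent" where
  "vandermonde_factor l = (\<Prod>j\<in>{1..l}. \<Prod>i\<in>{1..<j}. 1 - lratio (T j) (T i))"

definition multiset_product :: "nat \<Rightarrow> (gvar, 'a::comm_ring_1) mfps" where
  "multiset_product l =
     mfps_prod (\<lambda>R. inverse (1 - (\<Prod>i\<in>#R. mvar (T i)) * mvar V)) {R. set_mset R \<subseteq> {1..l}}"

definition tv_exponent :: "nat list \<Rightarrow> nat \<Rightarrow> gvar \<Rightarrow>\<^sub>0 int" where
  "tv_exponent lam n =
     (\<Sum>i\<in>{1..length lam}. Poly_Mapping.single (T i) (int (lam ! (i - 1)))) +
     Poly_Mapping.single V (int n)"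

end

theory Submission
  imports Defs
begin

text \<open>
  Both sides expand into the same alternating sum over permutations \<open>p\<close> of \<open>{0..<l}\<close>. On the left
  this is the Leibniz formula for the determinant \<open>S\<^sub>\<lambda>\<close>; on the right, \<open>\<Prod>i<j. (1 - t\<^sub>j/t\<^sub>i)\<close> is the
  Vandermonde determinant \<open>det (t\<^sub>i\<^bsup>i-j\<^esup>)\<close> (\<open>vandermonde_factor_eq_sum\<close>). Multiplication by
  \<open>\<Prod>i. t\<^sub>i\<^bsup>i - p i\<^esup>\<close> replaces the coefficient at \<open>\<lambda>\<close> by the one at \<open>\<lambda>\<^sub>i + p i - i\<close>, so it suffices to
  show for arbitrary integers \<open>a\<^sub>i\<close> that the average of \<open>\<Prod>i. H\<^bsub>a i\<^esub>\<close> over the symmetric group is the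
  coefficient of \<open>t\<^sup>a v\<^sup>n\<close> in \<open>\<Prod>R. (1 - t\<^sup>R v)\<^sup>-\<^sup>1\<close> (\<open>avg_prod_cH\<close>).

  This is an instance of Burnside's orbit-counting lemma. Let the symmetric group act on the functions
  \<open>f\<close> from \<open>{1..n}\<close> to multisets over \<open>{1..l}\<close> in which \<open>i\<close> occurs \<open>a\<^sub>i\<close> times in total.

  The fixed points of \<open>w\<close>: at the cycle type of \<open>w\<close>, the series \<open>\<Sum>d. H\<^sub>d t\<^sup>d\<close> becomes the product of
  \<open>(1 - t\<^bsup>|C|\<^esup>)\<^sup>-\<^sup>1\<close> over the cycles \<open>C\<close> of \<open>w\<close>. So \<open>H\<^sub>d\<close> counts the functions \<open>{1..n} \<rightarrow> \<nat>\<close> of sum \<open>d\<close>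
  that are constant on cycles, that is, fixed by \<open>w\<close> (\<open>ceval_cH_num_cycles\<close>,
  \<open>card_weighted_orbit_msets\<close>). An \<open>l\<close>-tuple of such functions, the \<open>i\<close>-th of sum \<open>a\<^sub>i\<close>, is a function
  \<open>f\<close> fixed by \<open>w\<close> (\<open>prod_card_invariant_functions\<close>), so \<open>\<Prod>i. H\<^bsub>a i\<^esub>\<close> counts the fixed points of \<open>w\<close>.

  The orbits: two functions lie in the same orbit if and only if they have the same multiset of
  values (\<open>burnside_image_mset\<close>). An orbit is therefore a multiset of \<open>n\<close> multisets \<open>R\<close> over \<open>{1..l}\<close>
  with total content \<open>a\<close>, and expanding the geometric series shows that the infinite product
  enumerates these (\<open>mfps_nth_multiset_product\<close>).
\<close>

unbundle no vec_syntax
no_notation Matrix.vec_index (infixl "$" 100)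
unbundle fps_syntax

section \<open>Multisets of prescribed weight\<close>

text \<open>
  The number of elements of this set is the coefficient of \<open>x\<^sup>m\<close> in
  \<open>\<Prod>R\<in>F. (1 - x\<^bsup>wt R\<^esup>)\<^sup>-\<^sup>1\<close>: choosing a term from every geometric series is the same as
  choosing a multiplicity for every \<open>R\<close>. This holds in one variable and in several, whence the
  abstract monoid of weights.
\<close>

definition weighted_msets :: "'r set \<Rightarrow> ('r \<Rightarrow> 'm::comm_monoid_add) \<Rightarrow> 'm \<Rightarrow> 'r multiset set" where
  "weighted_msets F wt m = {M. set_mset M \<subseteq> F \<and> (\<Sum>R\<in>#M. wt R) = m}"

lemma finite_msets_bounded_size:
  assumes "finite F"
  shows "finite {M. set_mset M \<subseteq> F \<and> size M \<le> N}"
proof -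
  have "{M. set_mset M \<subseteq> F \<and> size M \<le> N} = (\<Union>n\<le>N. multisets_of_size F n)"
    by (auto simp: multisets_of_size_def)
  then show ?thesis using assms by auto
qed

text \<open>
  A multiset either avoids \<open>R\<close> or arises from a unique multiset by adding one copy of \<open>R\<close>. On
  generating functions this reads \<open>G = G' + x\<^bsup>wt R\<^esup> * G\<close>, where \<open>G'\<close> leaves out \<open>R\<close>.
\<close>

lemma card_weighted_msets_insert:
  assumes "R \<notin> F" and "finite (weighted_msets (insert R F) wt m)"
  shows "card (weighted_msets (insert R F) wt m) =
    card (weighted_msets F wt m) +
    card {M. set_mset M \<subseteq> insert R F \<and> wt R + (\<Sum>Q\<in>#M. wt Q) = m}"
proof -
  let ?B = "{M. set_mset M \<subseteq> insert R F \<and> wt R + (\<Sum>Q\<in>#M. wt Q) = m}"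
  have eq: "weighted_msets (insert R F) wt m = weighted_msets F wt m \<union> add_mset R ` ?B"
  proof (intro subset_antisym subsetI)
    fix M assume M: "M \<in> weighted_msets (insert R F) wt m"
    show "M \<in> weighted_msets F wt m \<union> add_mset R ` ?B"
    proof (cases "R \<in># M")
      case True
      then obtain N where "M = add_mset R N" by (metis multi_member_split)
      with M show ?thesis by (auto simp: weighted_msets_def)
    next
      case False
      with M show ?thesis by (auto simp: weighted_msets_def)
    qed
  qed (auto simp: weighted_msets_def)
  have "card (weighted_msets (insert R F) wt m) =
      card (weighted_msets F wt m) + card (add_mset R ` ?B)"
    unfolding eq
  proof (rule card_Un_disjoint)
    show "finite (weighted_msets F wt m)" "finite (add_mset R ` ?B)"
      using assms(2) unfolding eq finite_Un by blast+
    have "R \<in># M" if "M \<in> add_mset R ` ?B" for M using that by fastforce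
    moreover have "R \<notin># M" if "M \<in> weighted_msets F wt m" for M
      using that assms(1) unfolding weighted_msets_def by blast
    ultimately show "weighted_msets F wt m \<inter> add_mset R ` ?B = {}" by blast
  qed
  also have "card (add_mset R ` ?B) = card ?B"
    by (rule card_image) (auto simp: inj_on_def)
  finally show ?thesis .
qed

lemma card_weighted_msets_shift:
  fixes wt :: "'r \<Rightarrow> 'm::cancel_comm_monoid_add"
  shows "card {M. set_mset M \<subseteq> F \<and> wt R + (\<Sum>Q\<in>#M. wt Q) = wt R + b} =
    card (weighted_msets F wt b)"
  by (simp add: weighted_msets_def)

text \<open>
  Positive weights bound the size of a multiset by its weight, which gives finiteness here.
\<close>

lemma prod_inverse_fps_eq_card_weighted_msets:
  assumes "finite F" and "\<And>R. R \<in> F \<Longrightarrow> 0 < wt R"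
  shows "(\<Prod>R\<in>F. inverse (1 - fps_X ^ wt R)) =
    (Abs_fps (\<lambda>d. of_nat (card (weighted_msets F wt d))) :: 'a::field fps)"
  using assms
proof (induction F)
  case empty
  show ?case
  proof (rule fps_ext)
    fix d
    have "weighted_msets {} wt d = (if d = 0 then {{#}} else {})"
      by (auto simp: weighted_msets_def)
    then show "(\<Prod>R\<in>{}. inverse (1 - fps_X ^ wt R)) $ d =
        Abs_fps (\<lambda>d. of_nat (card (weighted_msets {} wt d)) :: 'a) $ d"
      by simp
  qed
next
  case (insert R F)
  let ?c = "\<lambda>F d. of_nat (card (weighted_msets F wt d)) :: 'a"
  let ?e = "wt R"
  have "size M \<le> (\<Sum>Q\<in>#M. wt Q)" if "set_mset M \<subseteq> insert R F" for M
    using that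
  proof (induction M)
    case (add Q M)
    with insert.prems[of Q] show ?case by force
  qed simp
  then have "weighted_msets (insert R F) wt d \<subseteq> {M. set_mset M \<subseteq> insert R F \<and> size M \<le> d}" for d
    unfolding weighted_msets_def by blast
  then have fin: "finite (weighted_msets (insert R F) wt d)" for d
    by (rule finite_subset) (use insert.hyps finite_msets_bounded_size[of "insert R F" d] in simp)
  have "Abs_fps (?c F) = (1 - fps_X ^ ?e) * Abs_fps (?c (insert R F))"
  proof (rule fps_ext)
    fix d
    have rec: "?c (insert R F) d = ?c F d +
        of_nat (card {M. set_mset M \<subseteq> insert R F \<and> ?e + (\<Sum>Q\<in>#M. wt Q) = d})"
      using card_weighted_msets_insert[OF insert.hyps(2) fin[of d]] by (simp only: of_nat_add)
    have step: "?c (insert R F) d = ?c F d + (if d < ?e then 0 else ?c (insert R F) (d - ?e))"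
    proof (cases "d < ?e")
      case False
      then obtain b where b: "d = ?e + b" by (metis le_Suc_ex not_less)
      have "?c (insert R F) d = ?c F d + ?c (insert R F) b"
        using rec unfolding b card_weighted_msets_shift .
      then show ?thesis by (simp add: b)
    next
      case True
      then have empty: "{M. set_mset M \<subseteq> insert R F \<and> ?e + (\<Sum>Q\<in>#M. wt Q) = d} = {}" by auto
      show ?thesis unfolding rec empty if_P[OF True] by (simp only: card.empty of_nat_0)
    qed
    have "((1 - fps_X ^ ?e) * Abs_fps (?c (insert R F))) $ d =
        ?c (insert R F) d - (if d < ?e then 0 else ?c (insert R F) (d - ?e))"
      by (simp add: left_diff_distrib fps_X_power_mult_nth)
    also have "\<dots> = ?c F d"
      by (subst step) (rule add_diff_cancel_right')
    finally show "Abs_fps (?c F) $ d = ((1 - fps_X ^ ?e) * Abs_fps (?c (insert R F))) $ d"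
      by simp
  qed
  moreover have "inverse (1 - fps_X ^ ?e :: 'a fps) * (1 - fps_X ^ ?e) = 1"
    by (rule inverse_mult_eq_1) (use insert.prems[of R] in simp)
  ultimately have "inverse (1 - fps_X ^ ?e) * Abs_fps (?c F) = Abs_fps (?c (insert R F))"
    by (simp only: mult.assoc[symmetric] mult_1_left)
  with insert show ?case by simp
qed

section \<open>Orbits of functions under permutations of the domain\<close>

text \<open>
  The functions on \<open>A\<close> with a given multiset of values form one orbit under permutations of \<open>A\<close>, so
  this is the orbit-counting lemma for a single orbit. Fixing \<open>f0\<close> in the orbit, the stabilizer of
  \<open>f\<close> has as many elements as the set of the \<open>w\<close> that carry \<open>f0\<close> to \<open>f\<close>, and these sets partition
  the symmetric group. Outside \<open>A\<close> all functions take the value \<open>c\<close>, so that they are determined by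
  their restriction to \<open>A\<close>.
\<close>

lemma burnside_image_mset_fixed:
  fixes c :: 'b
  assumes A: "finite A" and size: "size M = card A"
  shows "(\<Sum>w | w permutes A.
      card {f :: 'a \<Rightarrow> 'b. (\<forall>x. x \<notin> A \<longrightarrow> f x = c) \<and> image_mset f (mset_set A) = M \<and> f \<circ> w = f}) =
    fact (card A)"
proof -
  let ?X = "{f. (\<forall>x. x \<notin> A \<longrightarrow> f x = c) \<and> image_mset f (mset_set A) = M}"
  let ?W = "{w. w permutes A}"
  have finW: "finite ?W" by (rule finite_permutations[OF A])
  have finX: "finite ?X"
  proof (rule finite_subset)
    show "?X \<subseteq> {f. \<forall>x. (x \<in> A \<longrightarrow> f x \<in> set_mset M) \<and> (x \<notin> A \<longrightarrow> f x = c)}"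
      using A by auto
    show "finite {f. \<forall>x. (x \<in> A \<longrightarrow> f x \<in> set_mset M) \<and> (x \<notin> A \<longrightarrow> f x = c)}"
      by (rule finite_set_of_finite_funs) (use A in auto)
  qed
  have stable: "f \<circ> w \<in> ?X" if "f \<in> ?X" "w permutes A" for f w
  proof -
    have "image_mset (f \<circ> w) (mset_set A) = image_mset f (image_mset w (mset_set A))"
      by (simp add: multiset.map_comp)
    also have "image_mset w (mset_set A) = mset_set A"
      using that(2) by (simp add: image_mset_mset_set permutes_inj_on permutes_image)
    finally show ?thesis using that by (simp add: permutes_not_in comp_def)
  qed
  obtain f0 where f0: "f0 \<in> ?X"
  proof -
    obtain xs where xs: "mset xs = M" by (metis ex_mset)
    from A obtain ys where ys: "distinct ys" "set ys = A" by (metis finite_distinct_list)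
    have len: "length xs = length ys" using xs size ys by (metis distinct_card size_mset)
    define f where "f = (\<lambda>x. case map_of (zip ys xs) x of Some y \<Rightarrow> y | None \<Rightarrow> c)"
    have "map f ys = xs"
      using len ys by (intro nth_equalityI) (auto simp: f_def map_of_zip_nth)
    moreover have "mset_set A = mset ys" using ys by (metis mset_set_set)
    ultimately have "image_mset f (mset_set A) = M" using xs by (metis mset_map)
    moreover have "f x = c" if "x \<notin> A" for x
    proof -
      have "map_of (zip ys xs) x = None"
        using that ys len by (simp add: map_of_zip_is_None)
      then show ?thesis by (simp add: f_def)
    qed
    ultimately show ?thesis using that by blast
  qed
  \<comment> \<open>left translation by \<open>p\<close>, where \<open>f = f0 \<circ> p\<close>, matches the two sets\<close>
  have stab: "card {w\<in>?W. f \<circ> w = f} = card {w\<in>?W. f0 \<circ> w = f}" if f: "f \<in> ?X" for f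
  proof -
    have "image_mset f (mset_set A) = image_mset f0 (mset_set A)" using f f0 by simp
    from image_mset_eq_implies_permutes[OF A this] obtain p
      where p: "p permutes A" "\<forall>x\<in>A. f x = f0 (p x)" by blast
    have fp: "f0 \<circ> p = f"
      using p f f0 by (auto simp: fun_eq_iff) (metis permutes_not_in)
    have "bij_betw (\<lambda>w. p \<circ> w) {w\<in>?W. f \<circ> w = f} {w\<in>?W. f0 \<circ> w = f}"
    proof (rule bij_betw_byWitness[where f' = "\<lambda>w. Hilbert_Choice.inv p \<circ> w"])
      show "(\<lambda>w. p \<circ> w) ` {w\<in>?W. f \<circ> w = f} \<subseteq> {w\<in>?W. f0 \<circ> w = f}"
        using p fp by (auto simp: o_assoc permutes_compose)
      have "f \<circ> (Hilbert_Choice.inv p \<circ> w) = f0 \<circ> w" for w :: "'a \<Rightarrow> 'a"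
        using permutes_inv_o(1)[OF p(1)] fp by (metis comp_assoc comp_id)
      then show "(\<lambda>w. Hilbert_Choice.inv p \<circ> w) ` {w\<in>?W. f0 \<circ> w = f} \<subseteq> {w\<in>?W. f \<circ> w = f}"
        using permutes_inv[OF p(1)] by (auto simp: permutes_compose)
    qed (use permutes_inv_o[OF p(1)] in \<open>auto simp: o_assoc\<close>)
    then show ?thesis by (rule bij_betw_same_card)
  qed
  have "(\<Sum>w\<in>?W. card {f\<in>?X. f \<circ> w = f}) = (\<Sum>f\<in>?X. card {w\<in>?W. f \<circ> w = f})"
    unfolding card_eq_sum by (rule sum.swap_restrict[OF finW finX])
  also have "\<dots> = (\<Sum>f\<in>?X. card {w\<in>?W. f0 \<circ> w = f})"
    by (rule sum.cong[OF refl stab])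
  also have "\<dots> = card (\<Union>f\<in>?X. {w\<in>?W. f0 \<circ> w = f})"
    by (rule card_UN_disjoint[symmetric]) (use finX finW in auto)
  also have "(\<Union>f\<in>?X. {w\<in>?W. f0 \<circ> w = f}) = ?W" using stable[OF f0] by blast
  also have "card ?W = fact (card A)" by (rule card_permutations[OF refl A])
  finally show ?thesis by (simp only: mem_Collect_eq conj_assoc)
qed

text \<open>
  The orbit-counting lemma: orbits of functions on \<open>A\<close> are indexed by the multisets of values.
\<close>

lemma burnside_image_mset:
  fixes c :: 'b
  assumes A: "finite A" and fin: "finite \<M>" and size: "\<And>M. M \<in> \<M> \<Longrightarrow> size M = card A"
  shows "(\<Sum>w | w permutes A.
      card {f :: 'a \<Rightarrow> 'b. (\<forall>x. x \<notin> A \<longrightarrow> f x = c) \<and> image_mset f (mset_set A) \<in> \<M> \<and> f \<circ> w = f}) =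
    fact (card A) * card \<M>"
proof -
  define X where "X M w = {f :: 'a \<Rightarrow> 'b. (\<forall>x. x \<notin> A \<longrightarrow> f x = c) \<and>
    image_mset f (mset_set A) = M \<and> f \<circ> w = f}" for M w
  have finX: "finite (X M w)" for M w
  proof (rule finite_subset)
    show "X M w \<subseteq> {f. \<forall>x. (x \<in> A \<longrightarrow> f x \<in> set_mset M) \<and> (x \<notin> A \<longrightarrow> f x = c)}"
      using A by (auto simp: X_def)
    show "finite {f. \<forall>x. (x \<in> A \<longrightarrow> f x \<in> set_mset M) \<and> (x \<notin> A \<longrightarrow> f x = c)}"
      by (rule finite_set_of_finite_funs) (use A in auto)
  qed
  have "(\<Sum>w | w permutes A. card {f :: 'a \<Rightarrow> 'b. (\<forall>x. x \<notin> A \<longrightarrow> f x = c) \<and>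
      image_mset f (mset_set A) \<in> \<M> \<and> f \<circ> w = f}) =
    (\<Sum>w | w permutes A. card (\<Union>M\<in>\<M>. X M w))"
    by (intro sum.cong refl arg_cong[where f = card]) (auto simp: X_def)
  also have "\<dots> = (\<Sum>w | w permutes A. \<Sum>M\<in>\<M>. card (X M w))"
    by (intro sum.cong refl card_UN_disjoint fin) (use finX in \<open>auto simp: X_def\<close>)
  also have "\<dots> = (\<Sum>M\<in>\<M>. \<Sum>w | w permutes A. card (X M w))"
    by (rule sum.swap)
  also have "\<dots> = (\<Sum>M\<in>\<M>. fact (card A))"
    unfolding X_def by (intro sum.cong refl burnside_image_mset_fixed A size)
  finally show ?thesis by simp
qed

section \<open>Coefficients of the infinite product over multisets\<close>

definition mmonom :: "('x \<Rightarrow>\<^sub>0 nat) \<Rightarrow> ('x, 'a::comm_ring_1) mfps" where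
  "mmonom e = Abs_mfps (\<lambda>m. if m = e then 1 else 0)"

lemma mfps_nth_Abs [simp]: "mfps_nth (Abs_mfps f) m = f m"
  by (simp add: Abs_mfps_inverse)

lemma mfps_nth_mmonom: "mfps_nth (mmonom e) m = (if m = e then 1 else 0)"
  by (simp add: mmonom_def)

text \<open>
  Exponents are subtracted pointwise with truncation at 0, so that \<open>m - e\<close> is the complementary
  exponent only if \<open>e\<close> divides \<open>m\<close>.
\<close>

lemma mfps_nth_mmonom_mult:
  "mfps_nth (mmonom e * f) m = (if \<exists>b. m = e + b then mfps_nth f (m - e) else 0)"
proof -
  have "mfps_nth (mmonom e * f) m =
      (\<Sum>(a, b) | a + b = m. (if a = e then 1 else 0) * mfps_nth f b)"
    by (simp add: mmonom_def times_mfps.rep_eq)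
  also have "\<dots> = (\<Sum>(a, b) \<in> {(a, b). a + b = m \<and> a = e}. mfps_nth f b)"
    by (rule sum.mono_neutral_cong_right) (auto simp: finite_splittings split: if_splits)
  also have "\<dots> = (if \<exists>b. m = e + b then mfps_nth f (m - e) else 0)"
  proof (cases "\<exists>b. m = e + b")
    case True
    then have "{(a, b). a + b = m \<and> a = e} = {(e, m - e)}" by auto
    then show ?thesis using True by simp
  next
    case False
    then have "{(a, b). a + b = m \<and> a = e} = {}" by auto
    then show ?thesis using False by (simp only: sum.empty if_False)
  qed
  finally show ?thesis .
qed

lemma mmonom_mult: "mmonom a * mmonom b = mmonom (a + b)"
  by (rule mfps_eqI)
    (auto simp: mfps_nth_mmonom_mult mfps_nth_mmonom split: if_splits)

lemma mmonom_0: "mmonom 0 = 1"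
  by (rule mfps_eqI) (simp add: mmonom_def one_mfps.rep_eq)

lemma mvar_eq_mmonom: "mvar x = mmonom (Poly_Mapping.single x 1)"
  by (simp add: mvar_def mmonom_def)

lemma prod_mset_mmonom: "(\<Prod>i\<in>#R. mmonom (e i)) = mmonom (\<Sum>i\<in>#R. e i)"
  by (induction R) (simp_all add: mmonom_0 mmonom_mult)

definition mset_series :: "('r \<Rightarrow> 'x \<Rightarrow>\<^sub>0 nat) \<Rightarrow> 'r set \<Rightarrow> ('x, 'a::comm_ring_1) mfps" where
  "mset_series wt F = Abs_mfps (\<lambda>m. of_nat (card (weighted_msets F wt m)))"

text \<open>
  A distinguished variable \<open>v\<close> in which every factor is linear. The exponent of \<open>v\<close> then records the
  size of a multiset, which makes the sets to be counted finite.
\<close>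

locale linear_weight =
  fixes wt :: "'r \<Rightarrow> 'x \<Rightarrow>\<^sub>0 nat" and v :: 'x
  assumes linear: "Poly_Mapping.lookup (wt R) v = 1"
begin

lemma lookup_weight: "Poly_Mapping.lookup (\<Sum>R\<in>#M. wt R) v = size M"
  by (induction M) (simp_all add: linear lookup_add)

lemma size_weighted_msets: "M \<in> weighted_msets F wt m \<Longrightarrow> size M = Poly_Mapping.lookup m v"
  using lookup_weight by (auto simp: weighted_msets_def)

lemma finite_weighted_msets: "finite F \<Longrightarrow> finite (weighted_msets F wt m)"
  by (rule finite_subset[OF _ finite_msets_bounded_size[of F "Poly_Mapping.lookup m v"]])
    (auto simp: weighted_msets_def lookup_weight)

lemma mset_series_empty: "mset_series wt {} = 1"
proof (rule mfps_eqI)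
  fix m
  have "weighted_msets {} wt m = (if m = 0 then {{#}} else {})"
    by (auto simp: weighted_msets_def)
  then show "mfps_nth (mset_series wt {}) m = mfps_nth 1 m"
    by (simp add: mset_series_def one_mfps.rep_eq)
qed

lemma mset_series_insert:
  assumes "finite F" "R \<notin> F"
  shows "(1 - mmonom (wt R)) * mset_series wt (insert R F) =
    (mset_series wt F :: ('x, 'a::comm_ring_1) mfps)"
proof (rule mfps_eqI)
  fix m
  let ?c = "\<lambda>F m. of_nat (card (weighted_msets F wt m)) :: 'a"
  let ?e = "wt R"
  have rec: "?c (insert R F) m = ?c F m +
      of_nat (card {M. set_mset M \<subseteq> insert R F \<and> ?e + (\<Sum>Q\<in>#M. wt Q) = m})"
    using card_weighted_msets_insert[OF assms(2) finite_weighted_msets[of "insert R F" m]] assms(1)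
    by simp
  have step: "?c (insert R F) m = ?c F m +
      (if \<exists>b. m = ?e + b then ?c (insert R F) (m - ?e) else 0)"
  proof (cases "\<exists>b. m = ?e + b")
    case True
    then obtain b where b: "m = ?e + b" ..
    have "?c (insert R F) m = ?c F m + ?c (insert R F) b"
      using rec unfolding b card_weighted_msets_shift .
    then show ?thesis by (simp add: b)
  next
    case False
    then have empty: "{M. set_mset M \<subseteq> insert R F \<and> ?e + (\<Sum>Q\<in>#M. wt Q) = m} = {}" by blast
    show ?thesis unfolding rec empty if_not_P[OF False] by (simp only: card.empty of_nat_0)
  qed
  have "mfps_nth ((1 - mmonom ?e) * mset_series wt (insert R F)) m =
      ?c (insert R F) m - (if \<exists>b. m = ?e + b then ?c (insert R F) (m - ?e) else 0)"
    by (simp add: left_diff_distrib minus_mfps.rep_eq mfps_nth_mmonom_mult mset_series_def)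
  also have "\<dots> = ?c F m"
    by (subst step) (rule add_diff_cancel_right')
  finally show "mfps_nth ((1 - mmonom ?e) * mset_series wt (insert R F)) m =
      mfps_nth (mset_series wt F :: ('x, 'a) mfps) m"
    by (simp add: mset_series_def)
qed

lemma prod_inverse_eq_mset_series:
  assumes "finite F"
  shows "(\<Prod>R\<in>F. inverse (1 - mmonom (wt R))) = (mset_series wt F :: ('x, 'a::comm_ring_1) mfps)"
  using assms
proof (induction F)
  case empty
  show ?case by (simp add: mset_series_empty)
next
  case (insert R F)
  let ?D = "1 - mmonom (wt R) :: ('x, 'a) mfps"
  have one: "?D * mset_series wt {R} = 1"
    using mset_series_insert[of "{}" R] by (simp add: mset_series_empty)
  have "inverse ?D * ?D = 1"
    unfolding inverse_mfps_unique[OF one] by (subst mult.commute) (rule one)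
  then have "inverse ?D * (?D * mset_series wt (insert R F)) = mset_series wt (insert R F)"
    by (simp only: mult.assoc[symmetric] mult_1_left)
  then show ?case using insert by (simp add: mset_series_insert)
qed

text \<open>
  Only the finitely many \<open>R\<close> whose monomial divides \<open>x\<^sup>m\<close> can contribute to the coefficient at \<open>m\<close>.
  Hence this coefficient is already constant along the finite subproducts that contain all of them,
  which is the convergence of the infinite product.
\<close>

lemma weighted_msets_finite_support:
  assumes "inj wt"
  obtains F where "finite F" "F \<subseteq> I"
    "\<And>G. F \<subseteq> G \<Longrightarrow> G \<subseteq> I \<Longrightarrow> weighted_msets G wt m = weighted_msets I wt m"
proof
  let ?F = "{R\<in>I. \<exists>b. wt R + b = m}"
  have "wt ` ?F \<subseteq> fst ` {(a, b). a + b = m}"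
    by (auto intro!: image_eqI[where x = "(wt R, b)" for R b])
  then have "finite (wt ` ?F)" by (rule finite_subset) (simp add: finite_splittings)
  then show "finite ?F"
    by (rule finite_imageD) (rule inj_on_subset[OF assms subset_UNIV])
  fix G assume G: "?F \<subseteq> G" "G \<subseteq> I"
  have "set_mset M \<subseteq> G" if "M \<in> weighted_msets I wt m" for M
  proof
    fix R assume R: "R \<in># M"
    then obtain N where "M = add_mset R N" by (metis multi_member_split)
    with that have "wt R + (\<Sum>Q\<in>#N. wt Q) = m" "R \<in> I" by (auto simp: weighted_msets_def)
    then show "R \<in> G" using G(1) by blast
  qed
  with G(2) show "weighted_msets G wt m = weighted_msets I wt m"
    unfolding weighted_msets_def by blast
qed auto

lemma finite_weighted_msets_inj: "inj wt \<Longrightarrow> finite (weighted_msets I wt m)"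
  by (metis weighted_msets_finite_support finite_weighted_msets subset_refl)

lemma mfps_nth_mfps_prod_inverse:
  assumes "inj wt"
  shows "mfps_nth (mfps_prod (\<lambda>R. inverse (1 - mmonom (wt R))) I) m =
    (of_nat (card (weighted_msets I wt m)) :: 'a::comm_ring_1)"
proof -
  let ?P = "\<lambda>F. mfps_nth (\<Prod>R\<in>F. inverse (1 - mmonom (wt R))) m :: 'a"
  let ?c = "of_nat (card (weighted_msets I wt m)) :: 'a"
  obtain F where F: "finite F" "F \<subseteq> I"
    "\<And>G. F \<subseteq> G \<Longrightarrow> G \<subseteq> I \<Longrightarrow> weighted_msets G wt m = weighted_msets I wt m"
    by (rule weighted_msets_finite_support[OF assms, of I m]) blast
  have ev: "\<forall>\<^sub>F G in finite_subsets_at_top I. ?P G = ?c"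
    unfolding eventually_finite_subsets_at_top
  proof (intro exI[of _ F] conjI allI impI F(1,2))
    fix G assume G: "finite G \<and> F \<subseteq> G \<and> G \<subseteq> I"
    then have "?P G = of_nat (card (weighted_msets G wt m))"
      by (simp add: prod_inverse_eq_mset_series mset_series_def)
    also have "weighted_msets G wt m = weighted_msets I wt m" using F(3) G by blast
    finally show "?P G = ?c" .
  qed
  have "(THE c. \<forall>\<^sub>F G in finite_subsets_at_top I. ?P G = c) = ?c"
  proof (rule the_equality[of _ ?c])
    fix c assume "\<forall>\<^sub>F G in finite_subsets_at_top I. ?P G = c"
    with ev have "\<forall>\<^sub>F G in finite_subsets_at_top I. c = ?c" by eventually_elim simp
    then show "c = ?c" by simp
  qed (rule ev)
  then show ?thesis by (simp add: mfps_prod_def)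
qed

end

text \<open>
  The exponent of \<open>t\<^sup>R v\<close>.
\<close>

definition gexp :: "nat multiset \<Rightarrow> gvar \<Rightarrow>\<^sub>0 nat" where
  "gexp R = (\<Sum>i\<in>#R. Poly_Mapping.single (T i) 1) + Poly_Mapping.single V 1"

lemma lookup_gexp_T: "Poly_Mapping.lookup (gexp R) (T i) = count R i"
proof -
  have "Poly_Mapping.lookup (\<Sum>j\<in>#R. Poly_Mapping.single (T j) 1 :: gvar \<Rightarrow>\<^sub>0 nat) (T i) = count R i"
    by (induction R) (auto simp: lookup_add lookup_single when_def)
  then show ?thesis by (simp add: gexp_def lookup_add lookup_single)
qed

lemma lookup_gexp_V: "Poly_Mapping.lookup (gexp R) V = 1"
  by (induction R) (simp_all add: gexp_def lookup_add lookup_single)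

lemma inj_gexp: "inj gexp"
  by (rule injI) (metis lookup_gexp_T multiset_eqI)

interpretation gexp: linear_weight gexp V
  by standard (rule lookup_gexp_V)

lemma mfps_nth_multiset_product:
  "mfps_nth (multiset_product l) m =
    (of_nat (card (weighted_msets {R. set_mset R \<subseteq> {1..l}} gexp m)) :: 'a::comm_ring_1)"
proof -
  have "(\<Prod>i\<in>#R. mvar (T i)) * mvar V = (mmonom (gexp R) :: (gvar, 'a) mfps)" for R
    unfolding mvar_eq_mmonom prod_mset_mmonom mmonom_mult gexp_def ..
  then show ?thesis
    unfolding multiset_product_def by (simp only: gexp.mfps_nth_mfps_prod_inverse[OF inj_gexp])
qed

section \<open>Evaluation of character polynomials\<close>

definition monomial_value :: "(nat \<Rightarrow> 'k::comm_ring_1) \<Rightarrow> (nat \<Rightarrow>\<^sub>0 nat) \<Rightarrow> 'k" where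
  "monomial_value x m = (\<Prod>i\<in>Poly_Mapping.keys m. x i ^ Poly_Mapping.lookup m i)"

lemma monomial_value_superset:
  assumes "finite S" "Poly_Mapping.keys m \<subseteq> S"
  shows "monomial_value x m = (\<Prod>i\<in>S. x i ^ Poly_Mapping.lookup m i)"
  unfolding monomial_value_def
  by (rule prod.mono_neutral_left) (use assms in \<open>auto simp: in_keys_iff\<close>)

lemma monomial_value_add: "monomial_value x (a + b) = monomial_value x a * monomial_value x b"
proof -
  let ?S = "Poly_Mapping.keys a \<union> Poly_Mapping.keys b"
  have "monomial_value x (a + b) = (\<Prod>i\<in>?S. x i ^ Poly_Mapping.lookup (a + b) i)"
    by (rule monomial_value_superset) (use Poly_Mapping.keys_add[of a b] in auto)
  also have "\<dots> = (\<Prod>i\<in>?S. x i ^ Poly_Mapping.lookup a i) * (\<Prod>i\<in>?S. x i ^ Poly_Mapping.lookup b i)"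
    by (simp add: lookup_add power_add prod.distrib)
  also have "\<dots> = monomial_value x a * monomial_value x b"
    by (subst (1 2) monomial_value_superset[of ?S]) auto
  finally show ?thesis .
qed

text \<open>
  Evaluation of a polynomial and extraction of a coefficient from the product of a Laurent polynomial
  with a power series are both of this form, and the linearity of both comes from here.
\<close>

definition linear_extension :: "('m \<Rightarrow> 'k) \<Rightarrow> ('m \<Rightarrow>\<^sub>0 'k) \<Rightarrow> 'k::comm_ring_1" where
  "linear_extension \<phi> q = (\<Sum>m\<in>Poly_Mapping.keys q. Poly_Mapping.lookup q m * \<phi> m)"

lemma linear_extension_superset:
  assumes "finite S" "Poly_Mapping.keys q \<subseteq> S"
  shows "linear_extension \<phi> q = (\<Sum>m\<in>S. Poly_Mapping.lookup q m * \<phi> m)"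
  unfolding linear_extension_def
  by (rule sum.mono_neutral_left) (use assms in \<open>auto simp: in_keys_iff\<close>)

lemma linear_extension_0: "linear_extension \<phi> 0 = 0"
  by (simp add: linear_extension_def)

lemma linear_extension_add: "linear_extension \<phi> (p + q) = linear_extension \<phi> p + linear_extension \<phi> q"
proof -
  let ?S = "Poly_Mapping.keys p \<union> Poly_Mapping.keys q"
  have "linear_extension \<phi> (p + q) = (\<Sum>m\<in>?S. Poly_Mapping.lookup (p + q) m * \<phi> m)"
    by (rule linear_extension_superset) (use Poly_Mapping.keys_add[of p q] in auto)
  also have "\<dots> = (\<Sum>m\<in>?S. Poly_Mapping.lookup p m * \<phi> m) + (\<Sum>m\<in>?S. Poly_Mapping.lookup q m * \<phi> m)"
    by (simp add: lookup_add distrib_right sum.distrib)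
  also have "\<dots> = linear_extension \<phi> p + linear_extension \<phi> q"
    by (subst (1 2) linear_extension_superset[of ?S]) auto
  finally show ?thesis .
qed

lemma linear_extension_sum: "linear_extension \<phi> (\<Sum>i\<in>I. f i) = (\<Sum>i\<in>I. linear_extension \<phi> (f i))"
  by (induction I rule: infinite_finite_induct) (simp_all add: linear_extension_0 linear_extension_add)

lemma linear_extension_single: "linear_extension \<phi> (Poly_Mapping.single m c) = c * \<phi> m"
  by (subst linear_extension_superset[of "{m}"]) auto

lemma poly_mapping_eq_sum_single:
  "q = (\<Sum>m\<in>Poly_Mapping.keys q. Poly_Mapping.single m (Poly_Mapping.lookup q m))"
  by (rule poly_mapping_eqI)
    (auto simp: lookup_sum lookup_single when_def in_keys_iff sum.delta' if_distrib cong: if_cong)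

lemma ceval_eq_linear_extension: "ceval q x = linear_extension (monomial_value x) q"
  by (simp add: ceval_def linear_extension_def monomial_value_def)

lemma ceval_0 [simp]: "ceval 0 x = 0"
  by (simp add: ceval_eq_linear_extension linear_extension_0)

lemma ceval_add: "ceval (p + q) x = ceval p x + ceval q x"
  by (simp add: ceval_eq_linear_extension linear_extension_add)

lemma ceval_sum: "ceval (\<Sum>i\<in>I. f i) x = (\<Sum>i\<in>I. ceval (f i) x)"
  by (simp add: ceval_eq_linear_extension linear_extension_sum)

lemma ceval_single: "ceval (Poly_Mapping.single m c) x = c * monomial_value x m"
  by (simp add: ceval_eq_linear_extension linear_extension_single)

lemma ceval_mult: "ceval (p * q) x = ceval p x * ceval q x"
proof -
  have "ceval (\<Sum>a\<in>A. Poly_Mapping.single a (f a)) x * ceval (\<Sum>b\<in>B. Poly_Mapping.single b (g b)) x =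
    ceval ((\<Sum>a\<in>A. Poly_Mapping.single a (f a)) * (\<Sum>b\<in>B. Poly_Mapping.single b (g b))) x" for A B f g
    by (simp add: sum_product ceval_sum mult_single ceval_single monomial_value_add mult_ac)
  from this[where A = "Poly_Mapping.keys p" and B = "Poly_Mapping.keys q"
      and f = "Poly_Mapping.lookup p" and g = "Poly_Mapping.lookup q"]
  show ?thesis by (simp only: poly_mapping_eq_sum_single[symmetric])
qed

lemma ceval_cconst [simp]: "ceval (cconst c) x = c"
  by (simp add: cconst_def ceval_single monomial_value_def)

lemma ceval_1 [simp]: "ceval 1 x = 1"
  using ceval_cconst[of 1 x] by (simp add: cconst_def)

lemma ceval_cX [simp]: "ceval (cX i) x = x i"
  by (simp add: cX_def ceval_single monomial_value_def)

lemma ceval_uminus: "ceval (- p) x = - ceval p x"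
  using ceval_add[of p "- p" x] by (simp add: eq_neg_iff_add_eq_0 add.commute)

lemma ceval_diff: "ceval (p - q) x = ceval p x - ceval q x"
  using ceval_add[of p "- q" x] by (simp add: ceval_uminus)

lemma ceval_of_nat [simp]: "ceval (of_nat n) x = of_nat n"
  by (induction n) (simp_all add: ceval_add)

lemma ceval_of_int [simp]: "ceval (of_int n) x = of_int n"
  by (cases n) (simp_all add: ceval_diff ceval_uminus)

lemma ceval_prod: "ceval (\<Prod>i\<in>I. f i) x = (\<Prod>i\<in>I. ceval (f i) x)"
  by (induction I rule: infinite_finite_induct) (simp_all add: ceval_mult)

definition fps_ceval :: "(nat \<Rightarrow> 'k::comm_ring_1) \<Rightarrow> 'k cpoly fps \<Rightarrow> 'k fps" where
  "fps_ceval x f = Abs_fps (\<lambda>d. ceval (f $ d) x)"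

lemma fps_ceval_mult: "fps_ceval x (f * g) = fps_ceval x f * fps_ceval x g"
  by (rule fps_ext) (simp add: fps_ceval_def fps_mult_nth ceval_sum ceval_mult)

lemma fps_ceval_1: "fps_ceval x 1 = 1"
  by (rule fps_ext) (simp add: fps_ceval_def)

lemma fps_ceval_prod: "fps_ceval x (\<Prod>i\<in>I. f i) = (\<Prod>i\<in>I. fps_ceval x (f i))"
  by (induction I rule: infinite_finite_induct) (simp_all add: fps_ceval_1 fps_ceval_mult)

lemma fps_ceval_power: "fps_ceval x (f ^ n) = fps_ceval x f ^ n"
  by (induction n) (simp_all add: fps_ceval_1 fps_ceval_mult)

lemma fps_ceval_compose: "fps_ceval x (f oo g) = fps_ceval x f oo fps_ceval x g"
proof (rule fps_ext)
  fix d
  have "ceval (g ^ i $ d) x = fps_ceval x g ^ i $ d" for i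
    by (simp add: fps_ceval_power[symmetric]) (simp add: fps_ceval_def)
  then show "fps_ceval x (f oo g) $ d = (fps_ceval x f oo fps_ceval x g) $ d"
    by (simp add: fps_ceval_def[of x "f oo g"] fps_ceval_def[of x f] fps_compose_nth
        ceval_sum ceval_mult)
qed

lemma fps_ceval_cbinomial_series: "fps_ceval x (cbinomial_series a) = fps_binomial (ceval a x)"
proof (rule fps_ext)
  fix k
  have "fps_ceval x (cbinomial_series a) $ k = 1 / fact k * (\<Prod>i<k. ceval a x - of_nat i)"
    by (simp add: fps_ceval_def cbinomial_series_def ceval_mult ceval_prod ceval_diff)
  also have "\<dots> = fps_binomial (ceval a x) $ k"
    by (simp add: gbinomial_prod_rev atLeast0LessThan)
  finally show "fps_ceval x (cbinomial_series a) $ k = fps_binomial (ceval a x) $ k" .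
qed

lemma fps_ceval_neg_X_power: "fps_ceval x (- (fps_X ^ i)) = - (fps_X ^ i)"
  by (rule fps_ext) (simp add: fps_ceval_def ceval_uminus)

text \<open>
  For a natural number \<open>c\<close> the binomial series \<open>(1 + y)\<^bsup>-c\<^esup>\<close> is the inverse of the polynomial
  \<open>(1 + y)\<^sup>c\<close>; substitution of \<open>y = - x\<^sup>i\<close> preserves this.
\<close>

lemma fps_binomial_neg_of_nat_compose:
  assumes "0 < i"
  shows "fps_binomial (- of_nat c) oo (- (fps_X ^ i)) =
    (inverse (1 - fps_X ^ i) ^ c :: 'k::field_char_0 fps)"
proof -
  let ?Y = "- (fps_X ^ i) :: 'k fps"
  have Y: "?Y $ 0 = 0" using assms by simp
  have "fps_binomial (- of_nat c) * (1 + fps_X) ^ c = (1 :: 'k fps)"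
    using fps_binomial_add_mult[of "- of_nat c" "of_nat c :: 'k"] by (simp add: fps_binomial_of_nat)
  then have "(fps_binomial (- of_nat c) oo ?Y) * ((1 + fps_X) ^ c oo ?Y) = 1"
    by (metis fps_compose_mult_distrib[OF Y] fps_compose_1)
  also have "(1 + fps_X) ^ c oo ?Y = (1 + ?Y) ^ c"
    by (simp add: fps_compose_power[OF Y, symmetric] fps_compose_add_distrib fps_X_fps_compose_startby0[OF Y] del: fps_compose_uminus)
  also have "1 + ?Y = 1 - fps_X ^ i" by simp
  finally have one: "(fps_binomial (- of_nat c) oo ?Y) * (1 - fps_X ^ i) ^ c = 1" .
  have "(1 - fps_X ^ i :: 'k fps) * inverse (1 - fps_X ^ i) = 1"
    by (subst mult.commute, rule inverse_mult_eq_1) (use assms in simp)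
  then have two: "(1 - fps_X ^ i :: 'k fps) ^ c * inverse (1 - fps_X ^ i) ^ c = 1"
    by (metis power_mult_distrib power_one)
  have "fps_binomial (- of_nat c) oo ?Y =
      (fps_binomial (- of_nat c) oo ?Y) * ((1 - fps_X ^ i) ^ c * inverse (1 - fps_X ^ i) ^ c)"
    unfolding two by (rule mult_1_right[symmetric])
  also have "\<dots> = inverse (1 - fps_X ^ i) ^ c"
    unfolding mult.assoc[symmetric] one by (rule mult_1_left)
  finally show ?thesis .
qed

text \<open>
  As \<open>f i = 1 + O(x\<^bsup>i+1\<^esup>)\<close>, the factors after the one with index \<open>N\<close> do not change the coefficients up to
  \<open>N\<close>, so the partial products converge coefficientwise. The limit has constant term 1 and is
  therefore nonzero, as the notion of convergence of infinite products requires.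
\<close>

lemma fps_nth_prodinf:
  fixes f :: "nat \<Rightarrow> 'a::idom fps"
  assumes one: "\<And>i. f i $ 0 = 1" and gap: "\<And>i k. 0 < k \<Longrightarrow> k \<le> i \<Longrightarrow> f i $ k = 0"
    and "d \<le> N"
  shows "prodinf f $ d = (\<Prod>i\<le>N. f i) $ d"
proof -
  define P where "P = (\<lambda>N. \<Prod>i\<le>N. f i)"
  have step: "P (Suc N) $ d = P N $ d" if "d \<le> Suc N" for N d
  proof -
    have "P (Suc N) $ d = (\<Sum>k=0..d. f (Suc N) $ k * P N $ (d - k))"
      by (simp add: P_def mult.commute[of _ "f (Suc N)"] fps_mult_nth)
    also have "\<dots> = (\<Sum>k\<in>{0}. f (Suc N) $ k * P N $ (d - k))"
      by (rule sum.mono_neutral_right) (use gap[of _ "Suc N"] that in auto)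
    finally show ?thesis by (simp add: one)
  qed
  have stable: "P N $ d = P d $ d" if "d \<le> N" for N d
    using that by (induction N rule: dec_induct) (simp_all add: step)
  define L where "L = Abs_fps (\<lambda>d. P d $ d)"
  have "P \<longlonglongrightarrow> L"
    unfolding tendsto_fps_iff L_def
    by (auto intro!: eventually_sequentiallyI stable)
  moreover have "L $ 0 = 1" by (simp add: L_def P_def one)
  then have "L \<noteq> 0" by force
  ultimately have "f has_prod L"
    by (simp add: has_prod_def raw_has_prod_def P_def)
  then have "prodinf f = L" by (rule has_prod_unique[symmetric])
  then show ?thesis using stable[OF assms(3)] by (simp add: L_def P_def)
qed

text \<open>
  Evaluation commutes with finite products and with composition of power series, but the defining
  product of \<open>cH\<close> is infinite; cutting it off at any \<open>N \<ge> d\<close> leaves the coefficient at \<open>d\<close> unchanged.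
\<close>

lemma ceval_cH:
  fixes c :: "nat \<Rightarrow> nat"
  assumes "d \<le> N"
  shows "ceval (cH (int d)) (\<lambda>i. of_nat (c i)) =
    ((\<Prod>i\<le>N. inverse (1 - fps_X ^ Suc i) ^ c (Suc i)) $ d :: 'k::field_char_0)"
proof -
  define f :: "nat \<Rightarrow> 'k cpoly fps" where
    "f = (\<lambda>i. cbinomial_series (- cX (Suc i)) oo (- (fps_X ^ Suc i)))"
  let ?x = "\<lambda>i. of_nat (c i) :: 'k"
  have pow: "(- (fps_X ^ Suc i)) ^ j = ((-1) ^ j * fps_X ^ (Suc i * j) :: 'k cpoly fps)" for i j
    by (subst power_minus) (simp only: power_mult)
  have nth: "((- (fps_X ^ Suc i)) ^ j) $ k = (if k = Suc i * j then (-1) ^ j else 0 :: 'k cpoly)" for i j k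
    unfolding pow by (cases "even j") (simp_all del: mult_Suc)
  have one: "f i $ 0 = 1" for i
    by (simp add: f_def cbinomial_series_def cconst_def)
  have gap: "f i $ k = 0" if "0 < k" "k \<le> i" for i k
    unfolding f_def fps_compose_nth
  proof (rule sum.neutral, rule ballI)
    fix j
    have "k \<noteq> Suc i * j" using that by (cases j) auto
    then show "cbinomial_series (- cX (Suc i)) $ j * ((- (fps_X ^ Suc i)) ^ j) $ k = (0 :: 'k cpoly)"
      unfolding nth by simp
  qed
  have "cH (int d) = prodinf f $ d"
    by (simp add: cH_def f_def)
  also have "\<dots> = (\<Prod>i\<le>N. f i) $ d"
    by (rule fps_nth_prodinf[of f, OF one gap assms])
  finally have "ceval (cH (int d)) ?x = fps_ceval ?x (\<Prod>i\<le>N. f i) $ d"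
    by (simp add: fps_ceval_def)
  also have "fps_ceval ?x (f i) = inverse (1 - fps_X ^ Suc i) ^ c (Suc i)" for i
    unfolding f_def fps_ceval_compose fps_ceval_cbinomial_series fps_ceval_neg_X_power
      ceval_uminus ceval_cX
    by (rule fps_binomial_neg_of_nat_compose) simp
  then have "fps_ceval ?x (\<Prod>i\<le>N. f i) = (\<Prod>i\<le>N. inverse (1 - fps_X ^ Suc i) ^ c (Suc i))"
    by (simp only: fps_ceval_prod)
  finally show ?thesis .
qed

section \<open>Complete symmetric polynomials count invariant functions\<close>

lemma card_orbit_bounds:
  assumes "w permutes {1..n}" "C \<in> orbit w ` {1..n}"
  shows "0 < card C" "card C \<le> n"
proof -
  obtain x where x: "x \<in> {1..n}" "C = orbit w x" using assms(2) by blast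
  then have sub: "C \<subseteq> {1..n}" using permutes_orbit_subset[OF assms(1)] by blast
  then have fin: "finite C" by (rule finite_subset) simp
  show "0 < card C" using x fin orbit_nonempty[of w] by (simp add: card_gt_0_iff)
  show "card C \<le> n" using card_mono[OF _ sub] by simp
qed

text \<open>
  The product over cycle lengths, each factor raised to the number of cycles of that length, is the
  product over all cycles.
\<close>

lemma ceval_cH_num_cycles:
  assumes "w permutes {1..n}"
  shows "ceval (cH (int d)) (\<lambda>i. of_nat (num_cycles n w i)) =
    (of_nat (card (weighted_msets (orbit w ` {1..n}) card d)) :: 'k::field_char_0)"
proof -
  \<comment> \<open>\<open>?N \<ge> d\<close> makes the cut-off harmless, and \<open>?N \<ge> n\<close> makes it cover all cycle lengths\<close>
  let ?O = "orbit w ` {1..n}" and ?N = "d + n"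
  let ?h = "\<lambda>k. inverse (1 - fps_X ^ k) :: 'k fps"
  have "(\<Prod>i\<le>?N. ?h (Suc i) ^ num_cycles n w (Suc i)) =
      (\<Prod>i\<le>?N. \<Prod>C\<in>{C. C \<in> ?O \<and> card C - 1 = i}. ?h (card C))"
  proof (rule prod.cong[OF refl])
    fix i
    have "{C \<in> ?O. card C = Suc i} = {C. C \<in> ?O \<and> card C - 1 = i}"
      using card_orbit_bounds(1)[OF assms] by fastforce
    moreover have "?h (Suc i) ^ num_cycles n w (Suc i) = (\<Prod>C\<in>{C \<in> ?O. card C = Suc i}. ?h (card C))"
      by (simp add: num_cycles_def)
    ultimately show "?h (Suc i) ^ num_cycles n w (Suc i) =
        (\<Prod>C\<in>{C. C \<in> ?O \<and> card C - 1 = i}. ?h (card C))"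
      by simp
  qed
  also have "\<dots> = (\<Prod>C\<in>?O. ?h (card C))"
    by (rule prod.group) (use card_orbit_bounds(2)[OF assms] in fastforce)+
  also have "\<dots> = Abs_fps (\<lambda>d. of_nat (card (weighted_msets ?O card d)))"
    by (rule prod_inverse_fps_eq_card_weighted_msets) (use card_orbit_bounds(1)[OF assms] in auto)
  finally have prod_eq: "(\<Prod>i\<le>?N. ?h (Suc i) ^ num_cycles n w (Suc i)) =
    Abs_fps (\<lambda>d. of_nat (card (weighted_msets ?O card d)))" .
  show ?thesis unfolding ceval_cH[OF le_add1[of d n]] prod_eq fps_nth_Abs_fps ..
qed

lemma sum_mset_eq_sum_count:
  fixes g :: "'r \<Rightarrow> nat"
  assumes "finite F" "set_mset M \<subseteq> F"
  shows "(\<Sum>C\<in>#M. g C) = (\<Sum>C\<in>F. count M C * g C)"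
  using assms(2)
proof (induction M)
  case (add C M)
  have "(\<Sum>D\<in>F. count (add_mset C M) D * g D) =
      (\<Sum>D\<in>F. (if D = C then g D else 0) + count M D * g D)"
    by (rule sum.cong) auto
  also have "\<dots> = g C + (\<Sum>D\<in>F. count M D * g D)"
    using add.prems assms(1) by (simp add: sum.distrib)
  finally show ?case using add by simp
qed simp

text \<open>
  A function is fixed by \<open>w\<close> if and only if it is constant on the orbits of \<open>w\<close>, and then its values
  are multiplicities of the orbits; the value on an orbit \<open>C\<close> enters the sum over \<open>A\<close> once for every
  element of \<open>C\<close>. So \<open>H\<^sub>d\<close> takes at the cycle type of \<open>w\<close> the number of monomials of degree \<open>d\<close> in the
  variables indexed by \<open>A\<close> that \<open>w\<close> fixes, the trace of \<open>w\<close> on a symmetric power.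
\<close>

lemma card_weighted_orbit_msets:
  assumes A: "finite A" and w: "w permutes A"
  shows "card (weighted_msets (orbit w ` A) card d) =
    card {h. (\<forall>x. x \<notin> A \<longrightarrow> h x = 0) \<and> h \<circ> w = h \<and> sum h A = (d::nat)}"
    (is "card ?M = card ?H")
proof -
  let ?O = "orbit w ` A"
  define rep where "rep C = (SOME x. x \<in> C)" for C :: "'a set"
  define to_fun where "to_fun M x = (if x \<in> A then count M (orbit w x) else 0)" for M x
  define to_mset where "to_mset h = (\<Sum>C\<in>?O. replicate_mset (h (rep C)) C)" for h :: "'a \<Rightarrow> nat"
  have perm: "permutation w" using w A by (auto simp: permutation_permutes)
  have sub: "orbit w x \<subseteq> A" if "x \<in> A" for x using permutes_orbit_subset[OF w that] .
  have self: "x \<in> orbit w x" for x by (rule permutation_self_in_orbit[OF perm])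
  have eqI: "orbit w y = orbit w x" if "y \<in> orbit w x" for x y
    by (rule orbit_cyclic_eq3[OF cyclic_on_orbit'[OF perm] that])
  have rep: "rep C \<in> C" if "C \<in> ?O" for C
    using that orbit_nonempty[of w] some_in_eq[of C] unfolding rep_def by blast
  have orbit_rep: "orbit w (rep C) = C" if "C \<in> ?O" for C
    using rep[OF that] that eqI by blast
  have rep_A: "rep C \<in> A" if "C \<in> ?O" for C using rep[OF that] that sub by blast
  have count_to_mset: "count (to_mset h) C = (if C \<in> ?O then h (rep C) else 0)" for h C
  proof -
    have "count (to_mset h) C = (\<Sum>D\<in>?O. if D = C then h (rep D) else 0)"
      unfolding to_mset_def count_sum by (rule sum.cong) auto
    also have "\<dots> = (if C \<in> ?O then h (rep C) else 0)" using A by simp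
    finally show ?thesis .
  qed
  have sum_orbits: "(\<Sum>x\<in>A. g (orbit w x)) = (\<Sum>C\<in>?O. g C * card C)" for g :: "'a set \<Rightarrow> nat"
  proof -
    have "(\<Sum>x\<in>A. g (orbit w x)) = (\<Sum>C\<in>?O. \<Sum>x\<in>{x. x \<in> A \<and> orbit w x = C}. g (orbit w x))"
      by (rule sum.group[symmetric]) (use A in auto)
    also have "\<dots> = (\<Sum>C\<in>?O. g C * card C)"
    proof (rule sum.cong[OF refl])
      fix C assume "C \<in> ?O"
      then have C: "{x. x \<in> A \<and> orbit w x = C} = C" using self sub eqI by blast
      have "(\<Sum>x\<in>{x. x \<in> A \<and> orbit w x = C}. g (orbit w x)) =
          (\<Sum>x\<in>{x. x \<in> A \<and> orbit w x = C}. g C)"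
        by (rule sum.cong[OF refl]) simp
      also have "\<dots> = g C * card C" unfolding C by simp
      finally show "(\<Sum>x\<in>{x. x \<in> A \<and> orbit w x = C}. g (orbit w x)) = g C * card C" .
    qed
    finally show ?thesis .
  qed
  have const: "h y = h x" if "h \<circ> w = h" "y \<in> orbit w x" for h :: "'a \<Rightarrow> nat" and x y
    using that(2) by induction (metis that(1) comp_apply)+
  have "bij_betw to_fun ?M ?H"
  proof (rule bij_betw_byWitness[where f' = to_mset])
    show "\<forall>M\<in>?M. to_mset (to_fun M) = M"
    proof
      fix M assume "M \<in> ?M"
      then have M: "count M C = 0" if "C \<notin> ?O" for C
        using that unfolding weighted_msets_def count_eq_zero_iff by blast
      show "to_mset (to_fun M) = M"
        by (rule multiset_eqI) (simp add: count_to_mset to_fun_def rep_A orbit_rep M)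
    qed
    show "\<forall>h\<in>?H. to_fun (to_mset h) = h"
    proof
      fix h assume h: "h \<in> ?H"
      show "to_fun (to_mset h) = h"
      proof
        fix x
        show "to_fun (to_mset h) x = h x"
        proof (cases "x \<in> A")
          case True
          then have "h (rep (orbit w x)) = h x" using h rep[of "orbit w x"] const by blast
          with True show ?thesis by (simp add: to_fun_def count_to_mset)
        qed (use h in \<open>simp add: to_fun_def\<close>)
      qed
    qed
    show "to_fun ` ?M \<subseteq> ?H"
    proof (rule image_subsetI)
      fix M assume M: "M \<in> ?M"
      have "sum (to_fun M) A = (\<Sum>x\<in>A. count M (orbit w x))"
        by (rule sum.cong) (simp_all add: to_fun_def)
      also have "\<dots> = (\<Sum>C\<in>?O. count M C * card C)" by (rule sum_orbits)
      also have "\<dots> = (\<Sum>C\<in>#M. card C)"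
        by (rule sum_mset_eq_sum_count[symmetric]) (use M A in \<open>auto simp: weighted_msets_def\<close>)
      finally have "sum (to_fun M) A = d" using M by (simp add: weighted_msets_def)
      moreover have "to_fun M \<circ> w = to_fun M"
        using permutes_in_image[OF w] permutation_orbit_step[OF perm] by (auto simp: to_fun_def)
      ultimately show "to_fun M \<in> ?H" by (simp add: to_fun_def)
    qed
    show "to_mset ` ?H \<subseteq> ?M"
    proof (rule image_subsetI)
      fix h assume h: "h \<in> ?H"
      have supp: "set_mset (to_mset h) \<subseteq> ?O"
      proof
        fix C assume "C \<in># to_mset h"
        then have "count (to_mset h) C \<noteq> 0" by simp
        then show "C \<in> ?O" unfolding count_to_mset by presburger
      qed
      have "(\<Sum>C\<in>#to_mset h. card C) = (\<Sum>C\<in>?O. count (to_mset h) C * card C)"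
        by (rule sum_mset_eq_sum_count[OF _ supp]) (use A in simp)
      also have "\<dots> = (\<Sum>C\<in>?O. h (rep C) * card C)"
        by (rule sum.cong) (simp_all add: count_to_mset)
      also have "\<dots> = (\<Sum>x\<in>A. h (rep (orbit w x)))"
        by (rule sum_orbits[of "\<lambda>C. h (rep C)", symmetric])
      also have "\<dots> = sum h A"
        by (rule sum.cong[OF refl]) (use h rep const in blast)
      finally show "to_mset h \<in> ?M" using h supp by (simp add: weighted_msets_def)
    qed
  qed
  then show ?thesis by (rule bij_betw_same_card)
qed

section \<open>Vandermonde determinants and Laurent polynomials\<close>

text \<open>
  Let \<open>q j = \<Prod>k<j. (X - x k)\<close>. Multiplying the Vandermonde matrix by the matrix of coefficients of
  the \<open>q j\<close> evaluates the \<open>q j\<close> at the \<open>x i\<close>. The second matrix is unitriangular, since \<open>q j\<close> is monic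
  of degree \<open>j\<close>, and the product is lower triangular, since \<open>q j\<close> vanishes at \<open>x i\<close> for \<open>i < j\<close>; its
  diagonal gives the determinant. This uses no division, hence applies to Laurent polynomials.
\<close>

lemma det_vandermonde:
  fixes x :: "nat \<Rightarrow> 'a::comm_ring_1"
  shows "Determinant.det (mat n n (\<lambda>(i, j). x i ^ j)) = (\<Prod>i<n. \<Prod>k<i. x i - x k)"
proof -
  define q where "q j = (\<Prod>k<j. [:- x k, 1:])" for j
  have q_Suc: "q (Suc j) = [:- x j, 1:] * q j" for j by (simp add: q_def mult.commute)
  have q: "degree (q j) \<le> j \<and> coeff (q j) j = 1" for j
  proof (induction j)
    case 0
    show ?case by (simp add: q_def)
  next
    case (Suc j)
    have "degree ([:- x j, 1:] * q j) \<le> degree [:- x j, 1:] + degree (q j)"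
      by (rule degree_mult_le)
    also have "\<dots> \<le> Suc j" using Suc by simp
    finally show ?case
      using Suc coeff_eq_0[of "q j" "Suc j"] by (simp add: q_Suc)
  qed
  have above: "coeff (q j) i = 0" if "j < i" for i j
    using q[of j] that by (intro coeff_eq_0) simp
  have poly_q: "poly (q j) (x i) = (\<Prod>k<j. x i - x k)" for i j
    by (simp add: q_def poly_prod)
  let ?V = "mat n n (\<lambda>(i, j). x i ^ j)"
  let ?U = "mat n n (\<lambda>(i, j). coeff (q j) i)"
  let ?L = "mat n n (\<lambda>(i, j). \<Prod>k<j. x i - x k)"
  have "?V * ?U = ?L"
  proof (rule eq_matI)
    fix i j assume "i < dim_row ?L" "j < dim_col ?L"
    then have ij: "i < n" "j < n" by auto
    have "(?V * ?U) $$ (i, j) = (\<Sum>k<n. x i ^ k * coeff (q j) k)"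
      using ij by (simp add: scalar_prod_def atLeast0LessThan)
    also have "\<dots> = (\<Sum>k\<le>degree (q j). x i ^ k * coeff (q j) k)"
      by (rule sum.mono_neutral_right)
        (use q[of j] ij in \<open>auto simp: coeff_eq_0 not_le\<close>)
    also have "\<dots> = poly (q j) (x i)" by (simp add: poly_altdef mult.commute)
    finally show "(?V * ?U) $$ (i, j) = ?L $$ (i, j)" using ij by (simp add: poly_q)
  qed auto
  then have "Determinant.det ?V * Determinant.det ?U = Determinant.det ?L"
    by (metis det_mult mat_carrier)
  also have "Determinant.det ?U = prod_list (diag_mat ?U)"
    by (rule det_upper_triangular[of _ n]) (auto intro!: upper_triangularI simp: above)
  also have "\<dots> = 1" using q by (simp add: prod_list_diag_prod)
  also have "Determinant.det ?L = prod_list (diag_mat ?L)"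
    by (rule det_lower_triangular[of n]) (auto intro!: prod_zero)
  also have "\<dots> = (\<Prod>i<n. \<Prod>k<i. x i - x k)"
    by (simp add: prod_list_diag_prod atLeast0LessThan)
  finally show ?thesis by simp
qed

text \<open>
  Lists and matrices are indexed from 0, but the variables \<open>T i\<close> from 1.
\<close>

abbreviation tsingle :: "nat \<Rightarrow> 'b \<Rightarrow> gvar \<Rightarrow>\<^sub>0 'b::zero" where
  "tsingle i \<equiv> Poly_Mapping.single (T (Suc i))"

lemma single_single_power:
  "Poly_Mapping.single (Poly_Mapping.single y a) (1 :: 'a::comm_ring_1) ^ k =
    Poly_Mapping.single (Poly_Mapping.single y (int k * a)) 1"
  by (induction k) (simp_all add: mult_single single_add[symmetric] distrib_right add.commute)

lemma prod_single:
  "(\<Prod>i\<in>I. Poly_Mapping.single (e i) (1 :: 'a::comm_ring_1)) = Poly_Mapping.single (\<Sum>i\<in>I. e i) 1"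
  for e :: "'i \<Rightarrow> 'x \<Rightarrow>\<^sub>0 int"
  by (induction I rule: infinite_finite_induct) (simp_all add: mult_single)

text \<open>
  Since \<open>1 - t\<^sub>j/t\<^sub>i = t\<^sub>j (t\<^sub>j\<^sup>-\<^sup>1 - t\<^sub>i\<^sup>-\<^sup>1)\<close>, the product is \<open>\<Prod>j. t\<^sub>j\<^sup>j\<close> (with \<open>j\<close> counted from 0) times the
  Vandermonde determinant in the \<open>t\<^sub>i\<^sup>-\<^sup>1\<close>, that is \<open>det (t\<^sub>i\<^bsup>i-j\<^esup>)\<close>.
\<close>

lemma vandermonde_factor_eq_sum:
  "vandermonde_factor l = (\<Sum>p | p permutes {0..<l}.
     Poly_Mapping.single (\<Sum>i<l. tsingle i (int i - int (p i))) (of_int (sign p) :: 'a::comm_ring_1))"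
proof -
  define y :: "nat \<Rightarrow> (gvar, 'a) laurent" where "y i = Poly_Mapping.single (tsingle i 1) 1" for i
  define z :: "nat \<Rightarrow> (gvar, 'a) laurent" where "z i = Poly_Mapping.single (tsingle i (- 1)) 1" for i
  have yz: "y j ^ a * z j ^ b = Poly_Mapping.single (tsingle j (int a - int b)) 1" for j a b
    by (simp add: y_def z_def single_single_power mult_single single_add[symmetric])
  have factor: "1 - lratio (T (Suc j)) (T (Suc i)) = y j * (z j - z i)" for i j
    using yz[of j 1 1]
    by (simp add: right_diff_distrib lratio_def y_def z_def mult_single single_uminus)
  have "vandermonde_factor l =
      (\<Prod>j<l. \<Prod>i<j. 1 - lratio (T (Suc j)) (T (Suc i)) :: (gvar, 'a) laurent)"
    unfolding vandermonde_factor_def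
    by (simp only: One_nat_def prod.atLeast1_atMost_eq prod.atLeast_Suc_lessThan_Suc_shift
        atLeast0LessThan comp_def)
  also have "\<dots> = (\<Prod>j<l. y j ^ j) * (\<Prod>j<l. \<Prod>i<j. z j - z i)"
    by (simp add: factor prod.distrib)
  also have "(\<Prod>j<l. \<Prod>i<j. z j - z i) =
      (\<Sum>p | p permutes {0..<l}. of_int (sign p) * (\<Prod>i<l. z i ^ p i))"
    unfolding det_vandermonde[symmetric] det_def'[OF mat_carrier]
    by (intro sum.cong refl arg_cong2[where f = "(*)"] prod.cong)
      (auto simp: permutes_in_image)
  also have "(\<Prod>j<l. y j ^ j) * \<dots> =
      (\<Sum>p | p permutes {0..<l}. of_int (sign p) * (\<Prod>i<l. y i ^ i * z i ^ p i))"
    by (simp add: sum_distrib_left prod.distrib mult_ac)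
  also have "\<dots> = (\<Sum>p | p permutes {0..<l}.
      Poly_Mapping.single (\<Sum>i<l. tsingle i (int i - int (p i))) (of_int (sign p)))"
    by (simp add: yz prod_single mult_single single_of_int[symmetric] del: single_of_int)
  finally show ?thesis .
qed

lemma laurent_mfps_coeff_eq_linear_extension:
  "laurent_mfps_coeff p f e = linear_extension (\<lambda>a. mfps_nth_int f (e - a)) p"
  by (simp add: laurent_mfps_coeff_def linear_extension_def)

section \<open>Functions into multisets as tuples of functions\<close>

text \<open>
  The exponent of \<open>t\<^sub>1\<^bsup>a 0\<^esup> \<cdots> t\<^sub>l\<^bsup>a (l-1)\<^esup> v\<^sup>b\<close>, for natural as well as for integer exponents.
\<close>

definition tv_exp :: "nat \<Rightarrow> (nat \<Rightarrow> 'b) \<Rightarrow> 'b \<Rightarrow> gvar \<Rightarrow>\<^sub>0 'b::comm_monoid_add" where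
  "tv_exp l a b = (\<Sum>i<l. tsingle i (a i)) + Poly_Mapping.single V b"

lemma lookup_tv_exp_V [simp]: "Poly_Mapping.lookup (tv_exp l a b) V = b"
  by (simp add: tv_exp_def lookup_add lookup_sum lookup_single)

lemma lookup_tv_exp_T [simp]:
  "Poly_Mapping.lookup (tv_exp l a b) (T k) = (if k \<in> {1..l} then a (k - 1) else 0)"
proof -
  have "Poly_Mapping.lookup (tv_exp l a b) (T k) = (\<Sum>i<l. if Suc i = k then a i else 0)"
    by (simp add: tv_exp_def lookup_add lookup_sum lookup_single when_def)
  also have "\<dots> = (\<Sum>i<l. if i = k - 1 then (if k = 0 then 0 else a i) else 0)"
    by (rule sum.cong) auto
  also have "\<dots> = (if k \<in> {1..l} then a (k - 1) else 0)"
    by auto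
  finally show ?thesis .
qed

text \<open>
  The condition on the exponent of \<open>v\<close> is satisfied by every \<open>f\<close>, because \<open>f\<close> has exactly \<open>card A\<close>
  values, counted with multiplicity.
\<close>

lemma gexp_weight_eq_iff:
  assumes "finite A"
  shows "image_mset f (mset_set A) \<in>
      weighted_msets {R. set_mset R \<subseteq> {1..l}} gexp (tv_exp l a (card A)) \<longleftrightarrow>
    (\<forall>x\<in>A. set_mset (f x) \<subseteq> {1..l}) \<and> (\<forall>i<l. (\<Sum>x\<in>A. count (f x) (Suc i)) = a i)"
proof (cases "\<forall>x\<in>A. set_mset (f x) \<subseteq> {1..l}")
  case True
  have total: "(\<Sum>R\<in>#image_mset f (mset_set A). gexp R) = (\<Sum>x\<in>A. gexp (f x))"
    by (simp add: multiset.map_comp sum_unfold_sum_mset comp_def)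
  have V: "Poly_Mapping.lookup (\<Sum>x\<in>A. gexp (f x)) V = card A"
    by (simp add: lookup_sum lookup_gexp_V)
  have T: "Poly_Mapping.lookup (\<Sum>x\<in>A. gexp (f x)) (T k) = (\<Sum>x\<in>A. count (f x) k)" for k
    by (simp add: lookup_sum lookup_gexp_T)
  have zero: "(\<Sum>x\<in>A. count (f x) k) = 0" if "k \<notin> {1..l}" for k
    using True that by (intro sum.neutral ballI) (meson count_eq_zero_iff subsetD)
  have "(\<Sum>x\<in>A. gexp (f x)) = tv_exp l a (card A) \<longleftrightarrow>
      (\<forall>i<l. (\<Sum>x\<in>A. count (f x) (Suc i)) = a i)" (is "?L \<longleftrightarrow> ?R")
  proof
    assume eq: ?L
    show ?R
    proof (intro allI impI)
      fix i assume "i < l"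
      then show "(\<Sum>x\<in>A. count (f x) (Suc i)) = a i"
        unfolding T[symmetric] eq by simp
    qed
  next
    assume R: ?R
    show ?L
    proof (rule poly_mapping_eqI)
      fix g
      show "Poly_Mapping.lookup (\<Sum>x\<in>A. gexp (f x)) g = Poly_Mapping.lookup (tv_exp l a (card A)) g"
      proof (cases g)
        case (T k)
        show ?thesis
        proof (cases "k \<in> {1..l}")
          case True
          then obtain i where "k = Suc i" "i < l" by (cases k) auto
          with R show ?thesis by (simp add: T \<open>g = T k\<close> lookup_sum lookup_gexp_T)
        next
          case False
          show ?thesis using zero[OF False] False by (auto simp: \<open>g = T k\<close> lookup_sum lookup_gexp_T)
        qed
      qed (simp add: V)
    qed
  qed
  moreover have "set_mset (image_mset f (mset_set A)) \<subseteq> {R. set_mset R \<subseteq> {1..l}}"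
    using True assms by auto
  ultimately show ?thesis
    unfolding weighted_msets_def mem_Collect_eq total using True by blast
next
  case False
  with assms show ?thesis by (auto simp: weighted_msets_def)
qed

text \<open>
  An \<open>l\<close>-tuple of functions \<open>A \<rightarrow> \<nat>\<close> is a function from \<open>A\<close> to the multisets over \<open>{1..l}\<close>, and the tuple
  is fixed by \<open>w\<close> componentwise.
\<close>

lemma prod_card_invariant_functions:
  fixes a :: "nat \<Rightarrow> nat" and A :: "'x set"
  assumes A: "finite A"
  shows "(\<Prod>i<l. card {h. (\<forall>x. x \<notin> A \<longrightarrow> h x = 0) \<and> h \<circ> w = h \<and> sum h A = a i}) =
    card {f. (\<forall>x. x \<notin> A \<longrightarrow> f x = {#}) \<and> image_mset f (mset_set A) \<in>
      weighted_msets {R. set_mset R \<subseteq> {1..l}} gexp (tv_exp l a (card A)) \<and> f \<circ> w = f}"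
    (is "_ = card ?F")
proof -
  let ?H = "\<lambda>i. {h. (\<forall>x. x \<notin> A \<longrightarrow> h x = 0) \<and> h \<circ> w = h \<and> sum h A = a i}"
  define split_up where
    "split_up f = restrict (\<lambda>i x. count (f x) (Suc i)) {..<l}" for f :: "'x \<Rightarrow> nat multiset"
  define combine where
    "combine H x = (\<Sum>i<l. replicate_mset (H i x) (Suc i))" for H :: "nat \<Rightarrow> 'x \<Rightarrow> nat" and x
  have count_combine: "count (combine H x) k = (if k \<in> {1..l} then H (k - 1) x else 0)" for H x k
  proof -
    have "count (combine H x) k = (\<Sum>i<l. if i = k - 1 then (if k = 0 then 0 else H i x) else 0)"
      unfolding combine_def count_sum by (rule sum.cong) auto
    also have "\<dots> = (if k \<in> {1..l} then H (k - 1) x else 0)" by auto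
    finally show ?thesis .
  qed
  have F: "f \<in> ?F \<longleftrightarrow> (\<forall>x. x \<notin> A \<longrightarrow> f x = {#}) \<and> (\<forall>x\<in>A. set_mset (f x) \<subseteq> {1..l}) \<and>
      (\<forall>i<l. (\<Sum>x\<in>A. count (f x) (Suc i)) = a i) \<and> f \<circ> w = f" for f
    unfolding mem_Collect_eq gexp_weight_eq_iff[OF A] by blast
  have "bij_betw split_up ?F (PiE {..<l} ?H)"
  proof (rule bij_betw_byWitness[where f' = combine])
    show "\<forall>f\<in>?F. combine (split_up f) = f"
    proof
      fix f assume f: "f \<in> ?F"
      have "set_mset (f x) \<subseteq> {1..l}" for x
        using f unfolding F by (cases "x \<in> A") auto
      then have zero: "count (f x) k = 0" if "k \<notin> {1..l}" for x k
        using that by (meson count_eq_zero_iff subsetD)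
      show "combine (split_up f) = f"
      proof (intro ext multiset_eqI)
        fix x k
        show "count (combine (split_up f) x) k = count (f x) k"
          using zero[of k x] by (auto simp: count_combine split_up_def)
      qed
    qed
    show "\<forall>H\<in>PiE {..<l} ?H. split_up (combine H) = H"
    proof
      fix H assume H: "H \<in> PiE {..<l} ?H"
      show "split_up (combine H) = H"
      proof
        fix i
        show "split_up (combine H) i = H i"
          using PiE_arb[OF H, of i] by (cases "i < l") (auto simp: split_up_def count_combine)
      qed
    qed
    show "split_up ` ?F \<subseteq> PiE {..<l} ?H"
    proof (rule image_subsetI)
      fix f assume f: "f \<in> ?F"
      have "f (w x) = f x" for x using f unfolding F by (metis comp_apply)
      then show "split_up f \<in> PiE {..<l} ?H"
        using f unfolding F by (auto simp: split_up_def)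
    qed
    show "combine ` PiE {..<l} ?H \<subseteq> ?F"
    proof (rule image_subsetI)
      fix H assume H: "H \<in> PiE {..<l} ?H"
      have Hi: "H i \<in> ?H i" if "i < l" for i using PiE_mem[OF H] that by blast
      have "combine H x = {#}" if "x \<notin> A" for x
        by (rule multiset_eqI) (use Hi that in \<open>auto simp: count_combine\<close>)
      moreover have "set_mset (combine H x) \<subseteq> {1..l}" for x
      proof
        fix k assume "k \<in># combine H x"
        then have "count (combine H x) k \<noteq> 0" by simp
        then show "k \<in> {1..l}" unfolding count_combine by presburger
      qed
      moreover have "(\<Sum>x\<in>A. count (combine H x) (Suc i)) = a i" if "i < l" for i
        using Hi[OF that] that by (simp add: count_combine)
      moreover have "combine H \<circ> w = combine H"
      proof (intro ext multiset_eqI)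
        fix x k
        have "H i (w x) = H i x" if "i < l" for i using Hi[OF that] by (metis (mono_tags) comp_apply mem_Collect_eq)
        then show "count ((combine H \<circ> w) x) k = count (combine H x) k"
          by (auto simp: count_combine)
      qed
      ultimately show "combine H \<in> ?F" unfolding F by blast
    qed
  qed
  then have "card ?F = card (PiE {..<l} ?H)" by (rule bij_betw_same_card)
  then show ?thesis by (simp only: card_PiE[OF finite_lessThan])
qed

section \<open>Averages of products and of determinants\<close>

text \<open>
  At a permutation \<open>w\<close> the product of the \<open>H\<close> counts the functions from \<open>{1..n}\<close> to multisets with
  prescribed totals that \<open>w\<close> fixes. Averaging over \<open>w\<close> counts the orbits of such functions, which are
  multisets of \<open>n\<close> multisets; and these are what the infinite product enumerates.
\<close>

lemma avg_prod_cH_nat: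
  "avg n (\<Prod>i<l. cH (int (a i))) =
    (mfps_nth (multiset_product l) (tv_exp l a n) :: 'k::field_char_0)"
proof -
  let ?A = "{1..n}"
  let ?M = "weighted_msets {R. set_mset R \<subseteq> {1..l}} gexp (tv_exp l a n)"
  let ?F = "\<lambda>w. {f. (\<forall>x. x \<notin> ?A \<longrightarrow> f x = {#}) \<and> image_mset f (mset_set ?A) \<in> ?M \<and> f \<circ> w = f}"
  have "ceval (\<Prod>i<l. cH (int (a i))) (\<lambda>i. of_nat (num_cycles n w i)) = (of_nat (card (?F w)) :: 'k)"
    if w: "w permutes ?A" for w
  proof -
    have "ceval (\<Prod>i<l. cH (int (a i))) (\<lambda>i. of_nat (num_cycles n w i)) =
        (of_nat (\<Prod>i<l. card (weighted_msets (orbit w ` ?A) card (a i))) :: 'k)"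
      by (simp only: ceval_prod ceval_cH_num_cycles[OF w] of_nat_prod)
    also have "(\<Prod>i<l. card (weighted_msets (orbit w ` ?A) card (a i))) = card (?F w)"
      using prod_card_invariant_functions[of ?A w a l]
      by (simp only: card_weighted_orbit_msets[OF finite_atLeastAtMost w] finite_atLeastAtMost
          card_atLeastAtMost True_implies_equals diff_Suc_1)
    finally show ?thesis .
  qed
  then have "avg n (\<Prod>i<l. cH (int (a i))) =
      (of_nat (\<Sum>w | w permutes ?A. card (?F w)) / fact n :: 'k)"
    unfolding avg_def of_nat_sum by simp
  also have "(\<Sum>w | w permutes ?A. card (?F w)) = fact (card ?A) * card ?M"
    by (rule burnside_image_mset)
      (use gexp.finite_weighted_msets_inj[OF inj_gexp] gexp.size_weighted_msets in \<open>auto simp del: One_nat_def\<close>)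
  finally show ?thesis by (simp add: mfps_nth_multiset_product)
qed

text \<open>
  Both sides vanish when some index is negative, the left one because \<open>H\<^sub>d = 0\<close> for \<open>d < 0\<close>.
\<close>

lemma avg_prod_cH:
  "avg n (\<Prod>i<l. cH (a i)) =
    (mfps_nth_int (multiset_product l) (tv_exp l a (int n)) :: 'k::field_char_0)"
proof (cases "\<forall>i<l. 0 \<le> a i")
  case True
  have "Poly_Mapping.map nat (tv_exp l a (int n)) = tv_exp l (\<lambda>i. nat (a i)) n"
  proof (rule poly_mapping_eqI)
    fix g
    show "Poly_Mapping.lookup (Poly_Mapping.map nat (tv_exp l a (int n))) g =
        Poly_Mapping.lookup (tv_exp l (\<lambda>i. nat (a i)) n) g"
      by (cases g) (auto simp: map.rep_eq when_def)
  qed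
  moreover have "0 \<le> Poly_Mapping.lookup (tv_exp l a (int n)) g" for g
    using True by (cases g) auto
  ultimately have "mfps_nth_int (multiset_product l) (tv_exp l a (int n)) =
      (mfps_nth (multiset_product l) (tv_exp l (\<lambda>i. nat (a i)) n) :: 'k)"
    by (simp add: mfps_nth_int_def)
  moreover have "(\<Prod>i<l. cH (a i)) = (\<Prod>i<l. cH (int (nat (a i))) :: 'k cpoly)"
    by (rule prod.cong) (use True in auto)
  ultimately show ?thesis by (simp only: avg_prod_cH_nat)
next
  case False
  then obtain i where i: "i < l" "a i < 0" by auto
  then have zero: "(\<Prod>i<l. cH (a i)) = (0 :: 'k cpoly)"
    by (intro prod_zero bexI[of _ i]) (simp_all add: cH_def)
  have "avg n (\<Prod>i<l. cH (a i)) = (0 :: 'k)"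
    unfolding zero by (simp add: avg_def)
  moreover have "\<not> 0 \<le> Poly_Mapping.lookup (tv_exp l a (int n)) (T (Suc i))"
    using i by simp
  ultimately show ?thesis by (metis mfps_nth_int_def)
qed

lemma avg_sum: "avg n (\<Sum>i\<in>I. f i) = (\<Sum>i\<in>I. avg n (f i))"
  unfolding avg_def ceval_sum by (subst sum.swap) (simp add: sum_divide_distrib)

lemma avg_of_int_mult: "avg n (of_int c * q) = of_int c * avg n q"
  by (simp add: avg_def ceval_mult sum_distrib_left[symmetric])

theorem corollary4p3:
  fixes lam :: "nat list" and n :: nat
  assumes "sorted_wrt (\<ge>) lam"
  shows "avg n (cS lam :: 'k::field_char_0 cpoly) =
    laurent_mfps_coeff (vandermonde_factor (length lam)) (multiset_product (length lam))
      (tv_exponent lam n)"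
proof -
  let ?l = "length lam"
  let ?a = "\<lambda>p i. int (lam ! i) + int (p i) - int i"
  let ?P = "{p. p permutes {0..<?l}}"
  have tv: "tv_exponent lam n = tv_exp ?l (\<lambda>i. int (lam ! i)) (int n)"
    unfolding tv_exponent_def tv_exp_def by (simp add: sum.atLeast1_atMost_eq)
  \<comment> \<open>the term of \<open>p\<close> in the Laurent polynomial shifts the exponents to the indices of \<open>H\<close> in the term of \<open>p\<close> in the determinant\<close>
  have shift: "tv_exponent lam n - (\<Sum>i<?l. tsingle i (int i - int (p i))) = tv_exp ?l (?a p) (int n)" for p
    unfolding tv
    by (simp add: tv_exp_def algebra_simps sum_subtractf[symmetric] single_diff[symmetric] single_add[symmetric] sum.distrib[symmetric])
  have "cS lam = (\<Sum>p\<in>?P. of_int (sign p) * (\<Prod>i<?l. cH (?a p i)) :: 'k cpoly)"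
    unfolding cS_def det_def'[OF mat_carrier]
    by (intro sum.cong refl arg_cong2[where f = "(*)"] prod.cong) (auto simp: permutes_in_image)
  then have "avg n (cS lam) = (\<Sum>p\<in>?P. of_int (sign p) * avg n (\<Prod>i<?l. cH (?a p i)) :: 'k)"
    by (simp only: avg_sum avg_of_int_mult)
  also have "\<dots> = (\<Sum>p\<in>?P. of_int (sign p) * mfps_nth_int (multiset_product ?l) (tv_exp ?l (?a p) (int n)))"
    by (simp only: avg_prod_cH)
  also have "\<dots> = laurent_mfps_coeff (vandermonde_factor ?l) (multiset_product ?l) (tv_exponent lam n)"
    unfolding laurent_mfps_coeff_eq_linear_extension vandermonde_factor_eq_sum
      linear_extension_sum linear_extension_single shift ..
  finally show ?thesis .
qed

end
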